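(* Let $u_1,\ldots,u_p\in\mathcal{U}$ (not necessarily distinct), let $X_l=S_{l,l+1}(u_l)=D_lY(u_l)D_{l+1}$ for $1\le l\le p$, and let $B=X_1X_2\cdots X_p$. Then for every $k\in\mathbb{N}$ $$\lim_{n\to\infty}\tau_1\big((BB^* )^k\big)=\sum_{\pi\in\mathcal{NC}(W^k)}\ \prod_{\text{blocks }V\text{ of }\pi} w(V),$$ where $w(V)=d(V)\,r_{|V|}(u_V)$ for each block $V$ of $\pi$.
   Context: **Random matrices.** Fix $p\in\mathbb{N}$. For each $n$ let $n=n_1+\ldots+n_{p+1}$ with natural numbers $n_j$ depending on $n$, such that $d_j=\lim_{n\to\infty}n_j/n>0$ exists for $1\le j\le p+1$ (the asymptotic dimensions). Let $D_j$ be the $n\times n$ diagonal matrix whose only nonzero entries are $(D_j)_{i,i}=1$ for $n_1+\ldots+n_{j-1}<i\le n_1+\ldots+n_j$. Let $\mathbb{E}$ be classical expectation, $\tau(A)=\frac1n\mathbb{E}(\mathrm{Tr}(A))$ for $n\times n$ random matrices, and $\tau_j(A)=\frac1{n_j}\mathbb{E}(\mathrm{Tr}(D_jA))$ the normalized partial traces. Let $\{Y(u):u\in\mathcal{U}\}$ be a family ($\mathcal U$ a finite set of labels) of independent Hermitian $n\times n$ random matrices (dependence on $n$ is suppressed) such that: (A1) the family is asymptotically free under $\tau$; (A2) the family is asymptotically free under $\tau$ against the family of deterministic diagonal matrices; (A3) the norms of the matrices $Y(u)$ are uniformly bounded almost surely. Let $\nu(u)$ be the limit distribution of $Y(u)$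 under $\tau$ and $(r_k(u))_{k\ge1}$ its free cumulants. **Adapted partitions.** Let $W=12\ldots p\,p^*\ldots 2^*1^*$, a word of length $2p$, and let $W^k$ be its $k$-th power, of length $2pk$. The element (leg) $s\in[2pk]=\{1,\ldots,2pk\}$ is colored by the $s$-th letter of $W^k$; a leg colored by $j$ or $j^*$ carries the label $u_j$. For a noncrossing partition $\pi\in\mathcal{NC}(2pk)$ and a block $V=\{s_1<\ldots<s_m\}$ put $\pi(s_i)=s_{i+1}$ for $i<m$ and $\pi(s_m)=s_1$. The partition $\pi$ is color adapted to $W^k$ if for each $s\in[2pk]$ either $\pi(s)\equiv s+1 \pmod{2p}$ or $\pi(s)\equiv 2p-s+1\pmod{2p}$ (all blocks then have even cardinality). It is label adapted if all legs of each block $V$ carry the same label, denoted $u_V$. $\mathcal{NC}(W^k)$ is the set of $\pi\in\mathcal{NC}(2pk)$ that are both color adapted and label adapted. **Dimension weights.** For $V=\{s_1<\ldots<s_m\}$ let $i_l=j+1$ if $s_l$ is colored by $j$, and $i_l=j$ if $s_l$ is colored by $j^*$, for $1\le l\le m-1$. Then $d(V)=d_{i_1}d_{i_2}\cdots d_{i_{m-1}}$. *)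

theory Defs
  imports
    "HOL-Probability.Probability"
    "HOL-Library.Poly_Mapping"
    "HOL-Library.Disjoint_Sets"
    "HOL-Number_Theory.Cong"
    "Jordan_Normal_Form.Schur_Decomposition"
begin

text \<open>
  The free unital algebra of noncommutative polynomials in indeterminates indexed by \<open>'i\<close> is
  the monoid algebra of the free monoid of words.  The wrapper type carries concatenation as
  addition, so that the convolution product of finitely supported functions is the product of
  noncommutative polynomials.
\<close>

datatype 'i ncword = NCWord (letters: "'i list")

instantiation ncword :: (type) monoid_add
begin

definition zero_ncword :: "'a ncword" where
  "zero_ncword = NCWord []"

definition plus_ncword :: "'a ncword \<Rightarrow> 'a ncword \<Rightarrow> 'a ncword" where
  "plus_ncword v w = NCWord (letters v @ letters w)"

instance
  by standard (simp_all add: zero_ncword_def plus_ncword_def)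

end

type_synonym 'i ncpoly = "'i ncword \<Rightarrow>\<^sub>0 complex"

definition nc_functional :: "('i list \<Rightarrow> complex) \<Rightarrow> 'i ncpoly \<Rightarrow> complex" where
  "nc_functional \<mu> f =
     (\<Sum>w\<in>Poly_Mapping.keys f. Poly_Mapping.lookup f w * \<mu> (letters w))"

definition nc_subalgebra :: "'i set \<Rightarrow> 'i ncpoly set" where
  "nc_subalgebra G = {f. \<forall>w\<in>Poly_Mapping.keys f. set (letters w) \<subseteq> G}"

text \<open>
  Freeness of the subalgebras generated by the sets of indeterminates in \<open>\<G>\<close>: the functional
  vanishes on every alternating product of centered elements.
\<close>

definition free_wrt :: "('i ncpoly \<Rightarrow> complex) \<Rightarrow> 'i set set \<Rightarrow> bool" where
  "free_wrt \<phi> \<G> \<longleftrightarrow>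
     (\<forall>Gs fs. Gs \<noteq> [] \<and> set Gs \<subseteq> \<G> \<and> distinct_adj Gs \<and> length fs = length Gs \<and>
        (\<forall>i<length Gs. fs ! i \<in> nc_subalgebra (Gs ! i) \<and> \<phi> (fs ! i) = 0)
        \<longrightarrow> \<phi> (prod_list fs) = 0)"

definition mat_trace :: "complex mat \<Rightarrow> complex" where
  "mat_trace A = (\<Sum>i<dim_row A. A $$ (i, i))"

definition mat_prod :: "nat \<Rightarrow> complex mat list \<Rightarrow> complex mat" where
  "mat_prod n As = foldr (*) As (1\<^sub>m n)"

definition hermitian_mat :: "complex mat \<Rightarrow> bool" where
  "hermitian_mat A \<longleftrightarrow> mat_adjoint A = A"

definition vec_norm2 :: "complex vec \<Rightarrow> real" where
  "vec_norm2 v = L2_set (\<lambda>i. cmod (vec_index v i)) {..<dim_vec v}"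

definition mat_op_norm :: "complex mat \<Rightarrow> real" where
  "mat_op_norm A =
     (SUP v\<in>{v \<in> carrier_vec (dim_col A). vec_norm2 v \<le> 1}. vec_norm2 (A *\<^sub>v v))"

text \<open>The states \<open>\<tau>\<close> and \<open>\<tau>\<^sub>j\<close>; \<open>P\<close> is the underlying probability measure.\<close>

definition tau :: "'w measure \<Rightarrow> nat \<Rightarrow> ('w \<Rightarrow> complex mat) \<Rightarrow> complex" where
  "tau P n A = (1 / of_nat n) * (\<integral>\<omega>. mat_trace (A \<omega>) \<partial>P)"

text \<open>Diagonal projection for the \<open>j\<close>-th block, for block sizes \<open>ns 1, ns 2, \<dots>\<close>; matrix indices
  start at 0.\<close>

definition diag_proj :: "nat \<Rightarrow> (nat \<Rightarrow> nat) \<Rightarrow> nat \<Rightarrow> complex mat" where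
  "diag_proj n ns j = mat n n (\<lambda>(a, b).
     if a = b \<and> (\<Sum>i=1..<j. ns i) \<le> a \<and> a < (\<Sum>i=1..j. ns i) then 1 else 0)"

definition tau_part ::
  "'w measure \<Rightarrow> nat \<Rightarrow> (nat \<Rightarrow> nat) \<Rightarrow> nat \<Rightarrow> ('w \<Rightarrow> complex mat) \<Rightarrow> complex" where
  "tau_part P n ns j A =
     (1 / of_nat (ns j)) * (\<integral>\<omega>. mat_trace (diag_proj n ns j * A \<omega>) \<partial>P)"

text \<open>
  A random matrix is identified with the random vector of its entries; measurability of the
  entries is part of the independence predicate for random variables.
\<close>

definition indep_random_matrices ::
  "'w measure \<Rightarrow> nat \<Rightarrow> ('u \<Rightarrow> 'w \<Rightarrow> complex mat) \<Rightarrow> 'u set \<Rightarrow> bool" where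
  "indep_random_matrices P n X U \<longleftrightarrow>
     prob_space.indep_vars P
       (\<lambda>_. Pi\<^sub>M ({..<n} \<times> {..<n}) (\<lambda>_. borel :: complex measure))
       (\<lambda>v \<omega>. \<lambda>ab\<in>{..<n} \<times> {..<n}. X v \<omega> $$ ab) U"

definition mixed_moment ::
  "'w measure \<Rightarrow> nat \<Rightarrow> ('i \<Rightarrow> 'w \<Rightarrow> complex mat) \<Rightarrow> 'i list \<Rightarrow> complex" where
  "mixed_moment P n X w = tau P n (\<lambda>\<omega>. mat_prod n (map (\<lambda>i. X i \<omega>) w))"

text \<open>
  The classes \<open>G \<in> \<G>\<close> of random matrices (\<open>X n i\<close> for \<open>i \<in> G\<close>) are asymptotically free: all mixed
  moments under \<open>\<tau>\<close> converge, and under the limit joint distribution the subalgebras generated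
  by the different classes are free.
\<close>

definition asymptotically_free ::
  "(nat \<Rightarrow> 'w measure) \<Rightarrow> (nat \<Rightarrow> 'i \<Rightarrow> 'w \<Rightarrow> complex mat) \<Rightarrow> 'i set set \<Rightarrow> bool" where
  "asymptotically_free M X \<G> \<longleftrightarrow>
     (\<exists>\<mu>. (\<forall>w. set w \<subseteq> \<Union>\<G> \<longrightarrow> (\<lambda>n. mixed_moment (M n) n (X n) w) \<longlonglongrightarrow> \<mu> w) \<and>
          free_wrt (nc_functional \<mu>) \<G>)"

text \<open>The limit distribution under \<open>\<tau>\<close> of a sequence of random matrices, as the sequence of its
  moments.\<close>

definition limit_moment :: "(nat \<Rightarrow> 'w measure) \<Rightarrow> (nat \<Rightarrow> 'w \<Rightarrow> complex mat) \<Rightarrow> nat \<Rightarrow> complex" where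
  "limit_moment M X k = lim (\<lambda>n. tau (M n) n (\<lambda>\<omega>. X n \<omega> ^\<^sub>m k))"

definition noncrossing :: "nat set set \<Rightarrow> bool" where
  "noncrossing \<pi> \<longleftrightarrow>
     (\<forall>V\<in>\<pi>. \<forall>V'\<in>\<pi>. \<forall>a\<in>V. \<forall>b\<in>V'. \<forall>c\<in>V. \<forall>d\<in>V'. a < b \<and> b < c \<and> c < d \<longrightarrow> V = V')"

definition NC :: "nat \<Rightarrow> nat set set set" where
  "NC N = {\<pi>. partition_on {1..N} \<pi> \<and> noncrossing \<pi>}"

text \<open>
  \<open>r\<close> is the sequence of free cumulants of the distribution with moments \<open>m\<close>.  The
  moment-cumulant formula determines \<open>r k\<close> for \<open>k \<ge> 1\<close> recursively, because the partition with
  a single block contributes \<open>r k\<close> to the \<open>k\<close>-th moment; \<open>r 0\<close> is irrelevant.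
\<close>

definition free_cumulants :: "(nat \<Rightarrow> complex) \<Rightarrow> (nat \<Rightarrow> complex) \<Rightarrow> bool" where
  "free_cumulants m r \<longleftrightarrow> (\<forall>k\<ge>1. m k = (\<Sum>\<pi>\<in>NC k. \<Prod>V\<in>\<pi>. r (card V)))"

datatype letter = Plain nat | Starred nat

fun letter_index :: "letter \<Rightarrow> nat" where
  "letter_index (Plain j) = j"
| "letter_index (Starred j) = j"

definition W :: "nat \<Rightarrow> letter list" where
  "W p = map Plain [1..<p+1] @ map Starred (rev [1..<p+1])"

definition W_pow :: "nat \<Rightarrow> nat \<Rightarrow> letter list" where
  "W_pow p k = concat (replicate k (W p))"

text \<open>Legs are numbered from 1, list positions from 0.\<close>

definition leg_color :: "nat \<Rightarrow> nat \<Rightarrow> nat \<Rightarrow> letter" where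
  "leg_color p k s = W_pow p k ! (s - 1)"

definition leg_label :: "nat \<Rightarrow> nat \<Rightarrow> (nat \<Rightarrow> 'u) \<Rightarrow> nat \<Rightarrow> 'u" where
  "leg_label p k u s = u (letter_index (leg_color p k s))"

text \<open>The cyclic successor of \<open>s\<close> in a block \<open>V\<close>, i.e. \<open>\<pi>(s)\<close> for \<open>s \<in> V \<in> \<pi>\<close>.\<close>

definition block_succ :: "nat set \<Rightarrow> nat \<Rightarrow> nat" where
  "block_succ V s = (if \<exists>t\<in>V. s < t then Min {t \<in> V. s < t} else Min V)"

definition color_adapted :: "nat \<Rightarrow> nat set set \<Rightarrow> bool" where
  "color_adapted p \<pi> \<longleftrightarrow>
     (\<forall>V\<in>\<pi>. \<forall>s\<in>V.
        [int (block_succ V s) = int s + 1] (mod (2 * int p)) \<or>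
        [int (block_succ V s) = 2 * int p - int s + 1] (mod (2 * int p)))"

definition label_adapted :: "nat \<Rightarrow> nat \<Rightarrow> (nat \<Rightarrow> 'u) \<Rightarrow> nat set set \<Rightarrow> bool" where
  "label_adapted p k u \<pi> \<longleftrightarrow>
     (\<forall>V\<in>\<pi>. \<forall>s\<in>V. \<forall>t\<in>V. leg_label p k u s = leg_label p k u t)"

definition NC_W :: "nat \<Rightarrow> nat \<Rightarrow> (nat \<Rightarrow> 'u) \<Rightarrow> nat set set set" where
  "NC_W p k u = {\<pi> \<in> NC (2 * p * k). color_adapted p \<pi> \<and> label_adapted p k u \<pi>}"

text \<open>The common label of the legs of a block of a label adapted partition.\<close>

definition block_label :: "nat \<Rightarrow> nat \<Rightarrow> (nat \<Rightarrow> 'u) \<Rightarrow> nat set \<Rightarrow> 'u" where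
  "block_label p k u V = leg_label p k u (Min V)"

fun dim_index :: "letter \<Rightarrow> nat" where
  "dim_index (Plain j) = j + 1"
| "dim_index (Starred j) = j"

definition dim_weight :: "nat \<Rightarrow> nat \<Rightarrow> (nat \<Rightarrow> real) \<Rightarrow> nat set \<Rightarrow> real" where
  "dim_weight p k d V = (\<Prod>s\<in>V - {Max V}. d (dim_index (leg_color p k s)))"

definition block_weight ::
  "nat \<Rightarrow> nat \<Rightarrow> (nat \<Rightarrow> real) \<Rightarrow> ('u \<Rightarrow> nat \<Rightarrow> complex) \<Rightarrow> (nat \<Rightarrow> 'u) \<Rightarrow> nat set \<Rightarrow> complex" where
  "block_weight p k d r u V = of_real (dim_weight p k d V) * r (block_label p k u V) (card V)"

definition block_product ::
  "nat \<Rightarrow> nat \<Rightarrow> (nat \<Rightarrow> nat) \<Rightarrow> ('u \<Rightarrow> complex mat) \<Rightarrow> (nat \<Rightarrow> 'u) \<Rightarrow> complex mat" where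
  "block_product n p ns Y u =
     mat_prod n (map (\<lambda>l. diag_proj n ns l * Y (u l) * diag_proj n ns (l + 1)) [1..<p+1])"

text \<open>Joint family of the random matrices (\<open>Inl\<close>) and the deterministic diagonal matrices (\<open>Inr\<close>).\<close>

definition joint_family ::
  "nat \<Rightarrow> (nat \<Rightarrow> nat) \<Rightarrow> ('u \<Rightarrow> 'w \<Rightarrow> complex mat) \<Rightarrow> 'u + nat \<Rightarrow> 'w \<Rightarrow> complex mat" where
  "joint_family n ns Y i \<omega> = (case i of Inl v \<Rightarrow> Y v \<omega> | Inr j \<Rightarrow> diag_proj n ns j)"

end

theory Submission
  imports Defs
begin

text \<open>
  The matrix \<open>D\<^sub>1 (B B\<^sup>*)\<^sup>k\<close> is a single word in the matrices \<open>Y(u)\<close> and the projections \<open>D\<^sub>j\<close>, so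
  \<open>\<tau>\<^sub>1((B B\<^sup>*)\<^sup>k)\<close> converges to \<open>\<kappa>(w) / d\<^sub>1\<close>, where \<open>\<kappa>\<close> is the joint limit distribution and \<open>w\<close> is that
  word.  It remains to compute \<open>\<kappa>(w)\<close>.  Freeness determines a joint distribution from the
  distributions of its classes (\<open>free_wrt_unique\<close>), so \<open>\<kappa>\<close> may be replaced by any model with the
  same freeness properties and the same marginals, and a model can be chosen in which the
  noncrossing partitions are visible.

  The model is a full Fock space whose vectors carry colours (\<open>fock_model\<close>).  A word is read from
  left to right, and its state is the colour \<open>c\<close> of the current gap between two letters together
  with a stack of legs that wait for the completion of their blocks.  A letter \<open>D\<^sub>j\<close> requires
  \<open>c = j\<close>.  A letter \<open>Y(v)\<close> either becomes a waiting leg, at the price \<open>d\<^sub>g\<close> for the colour \<open>g\<close> of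
  the next gap, or it completes a block with the top \<open>k\<close> waiting legs, at the price \<open>r\<^sub>k\<^sub>+\<^sub>1(v)\<close>; the
  next gap then has the colour of the gap before the first leg of the block.  This is
  Voiculescu's representation of a variable with free cumulants \<open>r\<close> as an annihilation operator
  plus \<open>\<Sum>\<^sub>k r\<^sub>k\<^sub>+\<^sub>1 l\<^sup>k\<close> with a creation operator \<open>l\<close>, written for the module over the colours.

  Freeness in the model rests on one computation: on a vector that is killed by the
  annihilation operators, a polynomial in the \<open>Y(v)\<close> acts as a combination of products of
  creation operators (\<open>foldr_op_Y\<close>).  The constant term of this combination is the expectation of
  the polynomial, so a centred polynomial really creates, and an alternating product of centred
  elements never returns to the vacuum (\<open>free_wrt_op_Y\<close>, \<open>free_wrt_op_letter\<close>).

  The sum over noncrossing partitions satisfies the same recursion as the model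
  (\<open>nc_sum_Cons\<close>): in a noncrossing partition the block completed at \<open>s\<close> consists of \<open>s\<close> and the
  most recent legs that still wait.  Without colours this identifies \<open>r(v)\<close> as the free cumulants
  of the model variable (\<open>nc_sum_eq_coef\<close>).  Along the word \<open>w\<close> it gives \<open>d\<^sub>1\<close> times the sum over
  all noncrossing partitions whose blocks have constant labels and matching gap colours
  (\<open>vac_state_leg_word\<close>).  Matching gap colours is exactly color adaptedness (\<open>colour_match\<close>), and
  the prices collected in a block multiply to its weight \<open>w(V)\<close>.
\<close>

section \<open>Noncrossing partitions read from left to right\<close>

definition nc_partitions :: "nat set \<Rightarrow> nat set set set" where
  "nc_partitions S = {\<pi>. partition_on S \<pi> \<and> noncrossing \<pi>}"

text \<open>
  The legs already read form \<open>st\<close>, with the leg read last at the head; \<open>ss\<close> contains the legs to the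
  right of them.  The legs in \<open>st\<close> wait: each of their blocks has a leg in \<open>ss\<close>.
\<close>

definition nc_sum :: "(nat set \<Rightarrow> complex) \<Rightarrow> nat list \<Rightarrow> nat list \<Rightarrow> complex" where
  "nc_sum wt st ss =
     (\<Sum>\<pi>\<in>{\<pi> \<in> nc_partitions (set st \<union> set ss). \<forall>V\<in>\<pi>. \<not> V \<subseteq> set st}. \<Prod>V\<in>\<pi>. wt V)"

lemma noncrossing_subset:
  assumes "noncrossing \<pi>" "\<pi>' \<subseteq> \<pi>"
  shows "noncrossing \<pi>'"
  unfolding noncrossing_def
proof (intro ballI impI)
  fix V V' a b c e assume "V \<in> \<pi>'" "V' \<in> \<pi>'" "a \<in> V" "b \<in> V'" "c \<in> V" "e \<in> V'"
    "a < b \<and> b < c \<and> c < e"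
  then show "V = V'"
    using assms(1)[unfolded noncrossing_def, rule_format, of V V' a b c e] assms(2) by auto
qed

lemma finite_nc_partitions: "finite S \<Longrightarrow> finite (nc_partitions S)"
  unfolding nc_partitions_def by (rule finite_subset[OF _ finitely_many_partition_on[of S]]) auto

lemma nc_sum_Nil [simp]: "nc_sum wt st [] = (if st = [] then 1 else 0)"
proof (cases "st = []")
  case True
  have "{\<pi> \<in> nc_partitions {}. \<forall>V\<in>\<pi>. \<not> V \<subseteq> {}} = {{}}"
    by (auto simp: nc_partitions_def noncrossing_def partition_on_empty)
  then show ?thesis using True by (simp add: nc_sum_def)
next
  case False
  have "{\<pi> \<in> nc_partitions (set st). \<forall>V\<in>\<pi>. \<not> V \<subseteq> set st} = {}"
  proof -
    have "\<exists>V\<in>\<pi>. V \<subseteq> set st" if "partition_on (set st) \<pi>" for \<pi>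
    proof -
      obtain a where "a \<in> set st" using False by (cases st) auto
      then show ?thesis using partition_onD1[OF that] by blast
    qed
    then show ?thesis by (auto simp: nc_partitions_def)
  qed
  then show ?thesis using False by (simp only: nc_sum_def set_simps Un_empty_right sum.empty if_False)
qed

lemma upclosed_eq_set_take:
  fixes xs :: "nat list"
  assumes "sorted_wrt (>) xs" "A \<subseteq> set xs"
    and "\<And>a b. a \<in> A \<Longrightarrow> b \<in> set xs \<Longrightarrow> a < b \<Longrightarrow> b \<in> A"
  shows "\<exists>k\<le>length xs. A = set (take k xs)"
  using assms
proof (induction xs arbitrary: A)
  case Nil
  then show ?case by simp
next
  case (Cons x xs)
  show ?case
  proof (cases "A = {}")
    case True
    then show ?thesis by (intro exI[of _ 0]) simp
  next
    case False
    have "x \<in> A"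
    proof -
      obtain a where a: "a \<in> A" using False by auto
      show ?thesis
      proof (cases "a = x")
        case False
        then have "a < x" using a Cons.prems(1,2) by auto
        then show ?thesis using Cons.prems(3)[OF a, of x] by simp
      qed (use a in simp)
    qed
    have "\<exists>k\<le>length xs. A - {x} = set (take k xs)"
    proof (rule Cons.IH)
      fix a b assume "a \<in> A - {x}" "b \<in> set xs" "a < b"
      moreover from this have "b < x" using Cons.prems(1) by auto
      ultimately show "b \<in> A - {x}" using Cons.prems(3)[of a b] by auto
    qed (use Cons.prems in auto)
    then obtain k where "k \<le> length xs" "A - {x} = set (take k xs)" by auto
    then show ?thesis using \<open>x \<in> A\<close> by (intro exI[of _ "Suc k"]) auto
  qed
qed

text \<open>
  The recursion that reads one leg \<open>s\<close>.  If the block of \<open>s\<close> continues to the right, then \<open>s\<close> joins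
  the waiting legs.  Otherwise \<open>s\<close> completes its block; a waiting leg between two legs of this block
  would belong to a block continued beyond \<open>s\<close> and hence produce a crossing, so the block consists of
  \<open>s\<close> and an initial segment of the stack.  Conversely, such a block is an interval of the legs not
  yet assigned to a complete block, and adding an interval never creates a crossing.
\<close>

lemma nc_sum_Cons:
  assumes st: "sorted_wrt (>) st" and ss: "sorted_wrt (<) (s # ss)"
    and lt: "\<And>a b. a \<in> set st \<Longrightarrow> b \<in> set (s # ss) \<Longrightarrow> a < b"
  shows "nc_sum wt st (s # ss) = nc_sum wt (s # st) ss +
     (\<Sum>k\<le>length st. wt (insert s (set (take k st))) * nc_sum wt (drop k st) ss)"
proof -
  define A where "A = set st"
  define R where "R = set ss"
  define X where "X = insert s (A \<union> R)"
  define B where "B k = insert s (set (take k st))" for k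
  define I where "I T = {\<pi> \<in> nc_partitions (T \<union> R). \<forall>V\<in>\<pi>. \<not> V \<subseteq> T}" for T
  define P where "P = {\<pi> \<in> nc_partitions X. \<forall>V\<in>\<pi>. \<not> V \<subseteq> A}"
  define Q where "Q k = insert (B k) ` I (set (drop k st))" for k
  have sR: "s < b" if "b \<in> R" for b using that ss by (auto simp: R_def)
  have As: "a < s" if "a \<in> A" for a using that lt by (auto simp: A_def)
  have sA: "s \<notin> A" using As by blast
  have dist: "distinct st"
    using st by (metis distinct_rev sorted_wrt_rev strict_sorted_iff)
  have td: "set (take k st) \<inter> set (drop k st) = {}" for k
    using dist by (metis append_take_drop_id distinct_append)
  have tdU: "set (take k st) \<union> set (drop k st) = A" for k
    unfolding A_def by (metis append_take_drop_id set_append)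
  have gt: "b < a" if "a \<in> set (take k st)" "b \<in> set (drop k st)" for a b k
    using that st by (metis append_take_drop_id sorted_wrt_append)
  have fin: "finite (I T)" if "finite T" for T
    unfolding I_def using that by (simp add: finite_nc_partitions R_def)
  have I_s: "s \<notin> \<Union>\<pi>" if "\<pi> \<in> I (set (drop k st))" for \<pi> k
  proof -
    have "\<Union>\<pi> = set (drop k st) \<union> R"
      using that by (auto simp: I_def nc_partitions_def partition_on_def)
    then show ?thesis using sA tdU[of k] sR by auto
  qed
  have I1: "I (insert s A) \<subseteq> P" by (auto simp: I_def P_def X_def)
  have Xk: "X - B k = set (drop k st) \<union> R" for k
    using sR As tdU[of k] td[of k] by (fastforce simp: X_def B_def)
  have Q_sub: "Q k \<subseteq> P - I (insert s A)" for k
  proof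
    fix \<rho> assume "\<rho> \<in> Q k"
    then obtain \<pi> where \<pi>: "\<pi> \<in> I (set (drop k st))" and \<rho>: "\<rho> = insert (B k) \<pi>"
      by (auto simp: Q_def)
    have part: "partition_on (X - B k) \<pi>" and nc: "noncrossing \<pi>"
      using \<pi> by (auto simp: I_def nc_partitions_def Xk)
    have BX: "B k \<subseteq> X" using tdU[of k] by (auto simp: B_def X_def)
    have disj: "\<Union>\<pi> \<inter> B k = {}" using partition_onD1[OF part] by auto
    have "partition_on X \<rho>"
      unfolding \<rho> partition_on_def
    proof (intro conjI)
      show "\<Union> (insert (B k) \<pi>) = X" using partition_onD1[OF part] BX by auto
      show "disjoint (insert (B k) \<pi>)"
        using partition_onD2[OF part] disj by (auto simp: disjoint_def)
      show "{} \<notin> insert (B k) \<pi>" using partition_onD3[OF part] by (auto simp: B_def)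
    qed
    moreover have intv: "x \<in> B k" if "a \<in> B k" "b \<in> B k" "a < x" "x < b" "x \<in> X" for a b x
    proof -
      have "a \<le> s" "b \<le> s"
        using that(1,2) As tdU[of k] by (auto simp: B_def intro: less_imp_le)
      then have "x \<in> A" using that sR[of x] by (auto simp: X_def)
      moreover have "x \<notin> set (drop k st)"
        using that gt[of a k x] As[OF \<open>x \<in> A\<close>] \<open>b \<le> s\<close>
        by (auto simp: B_def)
      ultimately show ?thesis using tdU[of k] by (auto simp: B_def)
    qed
    have sub: "V \<subseteq> X - B k" if "V \<in> \<pi>" for V
      using that partition_onD1[OF part] by auto
    have "noncrossing \<rho>"
      unfolding noncrossing_def \<rho>
    proof (intro ballI impI, elim conjE)
      fix V V' a b c e
      assume V: "V \<in> insert (B k) \<pi>" "V' \<in> insert (B k) \<pi>" "a \<in> V" "b \<in> V'" "c \<in> V" "e \<in> V'"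
        and lts: "a < b" "b < c" "c < e"
      show "V = V'"
      proof (cases "V = B k"; cases "V' = B k")
        assume 1: "V = B k" "V' \<noteq> B k"
        then have "b \<in> X - B k" using V sub by blast
        then show ?thesis using intv[of a c b] 1 V lts by auto
      next
        assume 1: "V \<noteq> B k" "V' = B k"
        then have "c \<in> X - B k" using V sub by blast
        then show ?thesis using intv[of b e c] 1 V lts by auto
      next
        assume "V \<noteq> B k" "V' \<noteq> B k"
        then show ?thesis using V lts nc[unfolded noncrossing_def, rule_format, of V V' a b c e] by auto
      qed simp
    qed
    moreover have "\<not> V \<subseteq> A" if "V \<in> \<rho>" for V
    proof (cases "V = B k")
      case True
      then show ?thesis using sA by (auto simp: B_def)
    next
      case False
      then have "V \<in> \<pi>" using that \<rho> by auto
      then have "\<not> V \<subseteq> set (drop k st)" "V \<subseteq> set (drop k st) \<union> R"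
        using \<pi> sub[of V] unfolding Xk by (auto simp: I_def)
      moreover have "R \<inter> A = {}" using sR As by (meson disjoint_iff less_asym)
      ultimately show ?thesis by blast
    qed
    moreover have "\<rho> \<notin> I (insert s A)"
      using tdU[of k] by (auto simp: I_def \<rho> B_def)
    ultimately show "\<rho> \<in> P - I (insert s A)" by (auto simp: P_def nc_partitions_def)
  qed
  have sub_Q: "P - I (insert s A) \<subseteq> (\<Union>k\<le>length st. Q k)"
  proof
    fix \<rho> assume \<rho>: "\<rho> \<in> P - I (insert s A)"
    then have part: "partition_on X \<rho>" and nc: "noncrossing \<rho>" and nA: "\<And>V. V \<in> \<rho> \<Longrightarrow> \<not> V \<subseteq> A"
      by (auto simp: P_def nc_partitions_def)
    obtain V where V: "V \<in> \<rho>" "V \<subseteq> insert s A"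
      using \<rho> by (auto simp: P_def I_def X_def)
    have sV: "s \<in> V" using V nA by blast
    have "\<exists>k\<le>length st. V - {s} = set (take k st)"
    proof (rule upclosed_eq_set_take[OF st])
      fix a b assume ab: "a \<in> V - {s}" "b \<in> set st" "a < b"
      \<comment> \<open>The block of \<open>b\<close> is continued to the right of \<open>s\<close>, so it crosses \<open>V\<close> unless it is \<open>V\<close>.\<close>
      have "b \<in> X" using ab by (auto simp: X_def A_def)
      then obtain V' where V': "V' \<in> \<rho>" "b \<in> V'" using partition_onD1[OF part] by auto
      show "b \<in> V - {s}"
      proof (cases "V' = V")
        case True
        then show ?thesis using V' ab sA by (auto simp: A_def)
      next
        case False
        have "V \<inter> V' = {}" using disjointD[OF partition_onD2[OF part] V(1) V'(1)] False by simp
        then have "s \<notin> V'" using sV by auto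
        moreover have "V' \<subseteq> X" using partition_onD1[OF part] V' by auto
        ultimately obtain e where e: "e \<in> V'" "e \<in> R" using nA[OF V'(1)] by (auto simp: X_def)
        have "b < s" using As ab by (auto simp: A_def)
        then have "V = V'"
          using nc[unfolded noncrossing_def, rule_format, of V V' a b s e] V V' e sV ab sR[OF e(2)]
          by auto
        then show ?thesis using False by simp
      qed
    qed (use V in \<open>auto simp: A_def\<close>)
    then obtain k where k: "k \<le> length st" "V - {s} = set (take k st)" by auto
    then have VB: "V = B k" using sV by (auto simp: B_def)
    have "partition_on (X - V) (\<rho> - {V})"
      unfolding partition_on_def
    proof (intro conjI)
      have "\<Union>(\<rho> - {V}) \<inter> V = {}"
        using disjointD[OF partition_onD2[OF part] _ V(1)] by blast
      then show "\<Union>(\<rho> - {V}) = X - V" using partition_onD1[OF part] V(1) by blast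
      show "disjoint (\<rho> - {V})"
        using partition_onD2[OF part] by (meson Diff_subset disjoint_def subsetD)
      show "{} \<notin> \<rho> - {V}" using partition_onD3[OF part] by simp
    qed
    then have "partition_on (set (drop k st) \<union> R) (\<rho> - {V})" by (simp add: VB Xk)
    moreover have "noncrossing (\<rho> - {V})" by (rule noncrossing_subset[OF nc]) blast
    moreover have "\<not> V' \<subseteq> set (drop k st)" if "V' \<in> \<rho>" for V'
      using nA[OF that] tdU[of k] by blast
    ultimately have "\<rho> - {V} \<in> I (set (drop k st))" by (auto simp: I_def nc_partitions_def)
    then have "\<rho> \<in> Q k" unfolding Q_def using V(1) VB by (intro image_eqI[of _ _ "\<rho> - {V}"]) auto
    then show "\<rho> \<in> (\<Union>k\<le>length st. Q k)" using k by auto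
  qed
  have Q_disj: "Q k \<inter> Q l = {}" if "k \<le> length st" "l \<le> length st" "k \<noteq> l" for k l
  proof (rule ccontr)
    assume "Q k \<inter> Q l \<noteq> {}"
    then obtain \<pi> \<pi>' where pp: "\<pi> \<in> I (set (drop k st))" "\<pi>' \<in> I (set (drop l st))"
      "insert (B k) \<pi> = insert (B l) \<pi>'" by (auto simp: Q_def)
    have "B l \<notin> \<pi>" using I_s[OF pp(1)] by (auto simp: B_def)
    then have "B k = B l" using pp(3) by blast
    moreover have "s \<notin> set (take k st)" "s \<notin> set (take l st)"
      using sA tdU[of k] tdU[of l] by auto
    ultimately have "set (take k st) = set (take l st)" by (simp add: B_def insert_ident)
    then have "card (set (take k st)) = card (set (take l st))" by simp
    then show False using that dist by (simp add: distinct_card)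
  qed
  have Q_sum: "(\<Sum>\<rho>\<in>Q k. \<Prod>V\<in>\<rho>. wt V) = wt (B k) * nc_sum wt (drop k st) ss" for k
  proof -
    have inj: "inj_on (insert (B k)) (I (set (drop k st)))"
    proof (rule inj_onI)
      fix \<pi> \<pi>' assume pp: "\<pi> \<in> I (set (drop k st))" "\<pi>' \<in> I (set (drop k st))"
        "insert (B k) \<pi> = insert (B k) \<pi>'"
      have "B k \<notin> \<pi>" "B k \<notin> \<pi>'" using I_s[OF pp(1)] I_s[OF pp(2)] by (auto simp: B_def)
      then show "\<pi> = \<pi>'" using pp(3) by (simp add: insert_ident)
    qed
    have "(\<Prod>V\<in>insert (B k) \<pi>. wt V) = wt (B k) * (\<Prod>V\<in>\<pi>. wt V)"
      if "\<pi> \<in> I (set (drop k st))" for \<pi>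
    proof (rule prod.insert)
      show "finite \<pi>"
        using that by (auto simp: I_def nc_partitions_def R_def intro: finite_elements)
      show "B k \<notin> \<pi>" using I_s[OF that] by (auto simp: B_def)
    qed
    then show ?thesis
      unfolding Q_def nc_sum_def
      unfolding sum.reindex[OF inj] sum_distrib_left I_def[symmetric] R_def[symmetric]
      by (intro sum.cong) (auto simp: I_def R_def)
  qed
  have finQ: "finite (Q k)" for k by (simp add: Q_def fin)
  have P_eq: "P = I (insert s A) \<union> (\<Union>k\<le>length st. Q k)"
    using sub_Q Q_sub I1 by blast
  have finI: "finite (I (insert s A))" by (intro fin) (simp add: A_def)
  have "nc_sum wt st (s # ss) = (\<Sum>\<pi>\<in>P. \<Prod>V\<in>\<pi>. wt V)"
    by (simp add: nc_sum_def P_def X_def A_def R_def)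
  also have "\<dots> = (\<Sum>\<pi>\<in>I (insert s A). \<Prod>V\<in>\<pi>. wt V) +
      (\<Sum>\<pi>\<in>(\<Union>k\<le>length st. Q k). \<Prod>V\<in>\<pi>. wt V)"
    unfolding P_eq using Q_sub finQ finI by (intro sum.union_disjoint) auto
  also have "(\<Sum>\<pi>\<in>(\<Union>k\<le>length st. Q k). \<Prod>V\<in>\<pi>. wt V)
      = (\<Sum>k\<le>length st. \<Sum>\<pi>\<in>Q k. \<Prod>V\<in>\<pi>. wt V)"
    using finQ Q_disj by (intro sum.UNION_disjoint) auto
  also have "(\<Sum>\<pi>\<in>I (insert s A). \<Prod>V\<in>\<pi>. wt V) = nc_sum wt (s # st) ss"
    by (simp add: nc_sum_def I_def A_def R_def)
  finally show ?thesis by (simp add: Q_sum B_def)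
qed

section \<open>Uniqueness of free joint distributions\<close>

lemma nc_functional_add: "nc_functional \<mu> (f + g) = nc_functional \<mu> f + nc_functional \<mu> g"
  unfolding nc_functional_def
  by (rule setsum_keys_plus_distrib[of "\<lambda>w c. c * \<mu> (letters w)"]) (simp_all add: algebra_simps)

lemma nc_functional_zero [simp]: "nc_functional \<mu> 0 = 0"
  by (simp add: nc_functional_def)

lemma nc_functional_sum: "nc_functional \<mu> (sum f A) = (\<Sum>a\<in>A. nc_functional \<mu> (f a))"
  by (induction A rule: infinite_finite_induct) (simp_all add: nc_functional_add)

lemma nc_functional_single [simp]:
  "nc_functional \<mu> (Poly_Mapping.single w c) = c * \<mu> (letters w)"
  by (simp add: nc_functional_def)

lemma nc_functional_one [simp]: "nc_functional \<mu> 1 = \<mu> []"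
  unfolding single_one[symmetric] nc_functional_single by (simp add: zero_ncword_def)

lemma sum_monomials:
  "(\<Sum>w\<in>Poly_Mapping.keys f. Poly_Mapping.single w (Poly_Mapping.lookup f w)) = f"
proof (rule poly_mapping_eqI)
  fix k
  have "Poly_Mapping.lookup (\<Sum>w\<in>Poly_Mapping.keys f. Poly_Mapping.single w (Poly_Mapping.lookup f w)) k
    = (\<Sum>w\<in>Poly_Mapping.keys f. if k = w then Poly_Mapping.lookup f w else 0)"
    unfolding lookup_sum lookup_single by (intro sum.cong refl) (simp add: when_def)
  also have "\<dots> = Poly_Mapping.lookup f k"
    by (simp add: sum.delta in_keys_iff)
  finally show "Poly_Mapping.lookup (\<Sum>w\<in>Poly_Mapping.keys f. Poly_Mapping.single w (Poly_Mapping.lookup f w)) k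
     = Poly_Mapping.lookup f k" .
qed

lemma nc_functional_mult:
  fixes f g :: "'i ncpoly"
  shows "nc_functional \<mu> (f * g) = nc_functional (\<lambda>v. nc_functional (\<lambda>w. \<mu> (v @ w)) g) f"
proof -
  have "f * g = (\<Sum>v\<in>Poly_Mapping.keys f. \<Sum>w\<in>Poly_Mapping.keys g.
      Poly_Mapping.single (v + w) (Poly_Mapping.lookup f v * Poly_Mapping.lookup g w))"
    by (subst (1 2) sum_monomials[symmetric]) (simp add: sum_product mult_single)
  then show ?thesis
    by (simp add: nc_functional_sum nc_functional_def[of _ f] nc_functional_def[of _ g]
        plus_ncword_def sum_distrib_left mult.assoc)
qed

lemma nc_functional_cmult: "nc_functional (\<lambda>w. c * \<mu> w) f = c * nc_functional \<mu> f"
  by (simp add: nc_functional_def sum_distrib_left algebra_simps)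

lemma nc_functional_cmult_right: "nc_functional (\<lambda>w. \<mu> w * c) f = nc_functional \<mu> f * c"
  by (simp add: nc_functional_def sum_distrib_left sum_distrib_right algebra_simps)

lemma nc_functional_plus:
  "nc_functional (\<lambda>w. \<mu> w + \<nu> w) f = nc_functional \<mu> f + nc_functional \<nu> f"
  by (simp add: nc_functional_def sum.distrib algebra_simps)

lemma nc_functional_sum_left:
  "nc_functional (\<lambda>w. \<Sum>a\<in>A. \<mu> a w) f = (\<Sum>a\<in>A. nc_functional (\<mu> a) f)"
  unfolding nc_functional_def sum_distrib_left by (rule sum.swap)

lemma nc_functional_cong:
  assumes "f \<in> nc_subalgebra G" "\<And>w. set w \<subseteq> G \<Longrightarrow> \<mu> w = \<nu> w"
  shows "nc_functional \<mu> f = nc_functional \<nu> f"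
  using assms unfolding nc_functional_def nc_subalgebra_def by (intro sum.cong) auto

lemma nc_subalgebra_mult:
  assumes "f \<in> nc_subalgebra G" "g \<in> nc_subalgebra G"
  shows "f * g \<in> nc_subalgebra G"
  unfolding nc_subalgebra_def
proof (intro CollectI ballI)
  fix w assume "w \<in> Poly_Mapping.keys (f * g)"
  then obtain a b where "w = a + b" "a \<in> Poly_Mapping.keys f" "b \<in> Poly_Mapping.keys g"
    using keys_mult[of f g] by blast
  then show "set (letters w) \<subseteq> G"
    using assms by (auto simp: nc_subalgebra_def plus_ncword_def)
qed

lemma nc_subalgebra_add_const:
  assumes "f \<in> nc_subalgebra G"
  shows "f + Poly_Mapping.single 0 c \<in> nc_subalgebra G"
proof -
  have "Poly_Mapping.keys (f + Poly_Mapping.single 0 c) \<subseteq> insert 0 (Poly_Mapping.keys f)"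
    using keys_add[of f "Poly_Mapping.single 0 c"] by (auto split: if_splits)
  then show ?thesis using assms unfolding nc_subalgebra_def zero_ncword_def by fastforce
qed

lemma nc_functional_scalar_middle:
  "nc_functional \<mu> (f * (Poly_Mapping.single 0 c * g)) = c * nc_functional \<mu> (f * g)"
  by (simp add: nc_functional_mult nc_functional_cmult zero_ncword_def)

lemma not_distinct_adj_decomp:
  "\<not> distinct_adj xs \<Longrightarrow> \<exists>as x bs. xs = as @ [x, x] @ bs"
proof (induction xs rule: induct_list012)
  case (3 x y zs)
  show ?case
  proof (cases "x = y")
    case True
    then show ?thesis by (intro exI[of _ "[]"]) simp
  next
    case False
    then obtain as z bs where "y # zs = as @ [z, z] @ bs" using 3 by auto
    then show ?thesis by (intro exI[of _ "x # as"]) auto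
  qed
qed simp_all

text \<open>
  Induction on the number of factors.  Two adjacent factors of the same class are merged.  In an
  alternating product each factor is split, from left to right, into a centred part and a constant;
  the constants leave shorter products, and what remains at the end is an alternating product of
  centred factors, where both functionals vanish.
\<close>

lemma free_wrt_unique_prod_list:
  assumes free: "free_wrt (nc_functional \<mu>) \<G>" "free_wrt (nc_functional \<nu>) \<G>"
    and ne: "\<G> \<noteq> {}" and unital: "\<mu> [] = 1"
    and agree: "\<And>G w. G \<in> \<G> \<Longrightarrow> set w \<subseteq> G \<Longrightarrow> \<mu> w = \<nu> w"
    and fs: "list_all2 (\<lambda>f G. f \<in> nc_subalgebra G) fs Gs" and Gs: "set Gs \<subseteq> \<G>"
  shows "nc_functional \<mu> (prod_list fs) = nc_functional \<nu> (prod_list fs)"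
  using fs Gs
proof (induction "length fs" arbitrary: fs Gs rule: less_induct)
  case less
  consider "fs = []" | "Gs \<noteq> []" "distinct_adj Gs" | "\<not> distinct_adj Gs"
    using less.prems(1) by (cases "Gs = []") auto
  then show ?case
  proof cases
    case 1
    then show ?thesis using agree[of _ "[]"] ne by auto
  next
    case 3
    then obtain as G bs where "Gs = as @ [G, G] @ bs"
      using not_distinct_adj_decomp by blast
    then obtain xs f g ys where split: "fs = xs @ [f, g] @ ys"
      "list_all2 (\<lambda>f G. f \<in> nc_subalgebra G) xs as" "f \<in> nc_subalgebra G" "g \<in> nc_subalgebra G"
      "list_all2 (\<lambda>f G. f \<in> nc_subalgebra G) ys bs"
      using less.prems(1) by (auto simp: list_all2_append2 list_all2_Cons2)
    let ?hs = "xs @ [f * g] @ ys"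
    have "nc_functional \<mu> (prod_list ?hs) = nc_functional \<nu> (prod_list ?hs)"
    proof (rule less.hyps)
      show "length ?hs < length fs" using split by simp
      show "list_all2 (\<lambda>f G. f \<in> nc_subalgebra G) ?hs (as @ [G] @ bs)"
        using split by (auto intro!: list_all2_appendI nc_subalgebra_mult)
      show "set (as @ [G] @ bs) \<subseteq> \<G>"
        using less.prems(2) \<open>Gs = _\<close> by auto
    qed
    then show ?thesis using split(1) by (simp add: mult.assoc)
  next
    case 2
    \<comment> \<open>The factors in \<open>gs\<close> are already centred; those in \<open>hs\<close> are still arbitrary.\<close>
    have centred: "nc_functional \<mu> (prod_list (gs @ hs)) = nc_functional \<nu> (prod_list (gs @ hs))"
      if "list_all2 (\<lambda>g G. g \<in> nc_subalgebra G \<and> nc_functional \<mu> g = 0) gs As"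
        "list_all2 (\<lambda>h G. h \<in> nc_subalgebra G) hs Bs" "Gs = As @ Bs" for gs hs As Bs
      using that
    proof (induction hs arbitrary: gs As Bs)
      case Nil
      then have As: "As = Gs" by simp
      have L: "length gs = length Gs" using Nil(1) As by (auto dest: list_all2_lengthD)
      have *: "gs ! i \<in> nc_subalgebra (Gs ! i) \<and> nc_functional \<mu> (gs ! i) = 0" if "i < length Gs" for i
        using Nil(1) that As L by (auto simp: list_all2_conv_all_nth)
      have "nc_functional \<nu> (gs ! i) = 0" if "i < length Gs" for i
        using *[OF that] nc_functional_cong[of "gs ! i" "Gs ! i" \<mu> \<nu>] agree[of "Gs ! i"]
          less.prems(2) nth_mem[OF that] by auto
      with *  have "nc_functional \<mu> (prod_list gs) = 0" "nc_functional \<nu> (prod_list gs) = 0"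
        using free[unfolded free_wrt_def, rule_format, of Gs gs] 2 L less.prems(2) by auto
      then show ?case by simp
    next
      case (Cons h hs)
      then obtain G Bs' where Bs: "Bs = G # Bs'" "h \<in> nc_subalgebra G"
        "list_all2 (\<lambda>h G. h \<in> nc_subalgebra G) hs Bs'"
        by (auto simp: list_all2_Cons1)
      define c where "c = nc_functional \<mu> h"
      define h' where "h' = h + Poly_Mapping.single 0 (- c)"
      have h: "h = h' + Poly_Mapping.single 0 c"
        unfolding h'_def add.assoc single_add[symmetric] by simp
      have h': "h' \<in> nc_subalgebra G" "nc_functional \<mu> h' = 0"
        using Bs(2) nc_subalgebra_add_const[of h G "- c"]
        by (simp_all add: h'_def nc_functional_add c_def zero_ncword_def unital)
      have "nc_functional \<mu> (prod_list ((gs @ [h']) @ hs)) = nc_functional \<nu> (prod_list ((gs @ [h']) @ hs))"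
        by (rule Cons.IH[of _ "As @ [G]" Bs'])
          (use Cons.prems Bs h' in \<open>auto intro!: list_all2_appendI\<close>)
      moreover have "nc_functional \<mu> (prod_list (gs @ hs)) = nc_functional \<nu> (prod_list (gs @ hs))"
      proof (rule less.hyps)
        show "length (gs @ hs) < length fs"
          using Cons.prems less.prems(1) by (auto dest!: list_all2_lengthD)
        show "list_all2 (\<lambda>f G. f \<in> nc_subalgebra G) (gs @ hs) (As @ Bs')"
          using Cons.prems(1) Bs by (auto intro!: list_all2_appendI elim: list_all2_mono)
        show "set (As @ Bs') \<subseteq> \<G>" using Cons.prems(3) Bs less.prems(2) by auto
      qed
      moreover have "nc_functional \<kappa> (prod_list (gs @ h # hs)) =
          nc_functional \<kappa> (prod_list ((gs @ [h']) @ hs)) + c * nc_functional \<kappa> (prod_list (gs @ hs))" for \<kappa>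
      proof -
        have "prod_list (gs @ h # hs) = prod_list ((gs @ [h']) @ hs)
            + prod_list gs * (Poly_Mapping.single 0 c * prod_list hs)"
          unfolding h by (simp add: algebra_simps)
        then show ?thesis by (simp add: nc_functional_add nc_functional_scalar_middle)
      qed
      ultimately show ?case by simp
    qed
    show ?thesis using centred[of "[]" "[]" fs Gs] less.prems(1) by simp
  qed
qed

text \<open>
  Freeness determines a unital functional from its restrictions to the classes: a word is the
  product of its letters, each of which belongs to a class.
\<close>

lemma free_wrt_unique:
  assumes "free_wrt (nc_functional \<mu>) \<G>" "free_wrt (nc_functional \<nu>) \<G>" "\<G> \<noteq> {}" "\<mu> [] = 1"
    and "\<And>G w. G \<in> \<G> \<Longrightarrow> set w \<subseteq> G \<Longrightarrow> \<mu> w = \<nu> w"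
    and w: "set w \<subseteq> \<Union>\<G>"
  shows "\<mu> w = \<nu> w"
proof -
  define x where "x i = (Poly_Mapping.single (NCWord [i]) 1 :: 'a ncpoly)" for i
  have prod: "prod_list (map x w) = Poly_Mapping.single (NCWord w) 1"
  proof (induction w)
    case Nil
    show ?case unfolding zero_ncword_def[symmetric] by simp
  next
    case (Cons i w)
    then show ?case by (simp add: x_def mult_single plus_ncword_def)
  qed
  define g where "g i = (SOME G. G \<in> \<G> \<and> i \<in> G)" for i
  have g: "g i \<in> \<G> \<and> i \<in> g i" if "i \<in> set w" for i
    unfolding g_def by (rule someI_ex) (use w that in auto)
  have "nc_functional \<mu> (prod_list (map x w)) = nc_functional \<nu> (prod_list (map x w))"
    by (rule free_wrt_unique_prod_list[OF assms(1-5), where Gs = "map g w"])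
      (use g in \<open>auto simp: list.rel_map x_def nc_subalgebra_def intro: list.rel_refl_strong\<close>)
  then show ?thesis by (simp add: prod)
qed

section \<open>A coloured Fock space\<close>

text \<open>
  A vector is a function of a colour and a stack of pairs \<open>(v, c')\<close>; such a pair is a waiting leg
  with label \<open>v\<close>, and \<open>c'\<close> is the colour of the gap before it.  The value \<open>F c st\<close> is the total weight
  of the remaining word when it is read from the state \<open>(c, st)\<close>, so operators compose in the order
  of the letters.  Seen as operators on such functions,
  the part of \<open>op_Y\<close> that pushes onto the stack is the annihilation operator and the part that pops
  is the sum of powers of the creation operator.
\<close>

locale fock_model =
  fixes C :: "'c set" and d :: "'c \<Rightarrow> complex" and r :: "'u \<Rightarrow> nat \<Rightarrow> complex"
  assumes finite_colours: "finite C" and sum_d: "(\<Sum>c\<in>C. d c) = 1"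
begin

text \<open>
  The weights of all ways to complete a block of label \<open>v\<close> at the current letter, when \<open>m\<close> waiting
  legs have already been taken into this block.  The colour \<open>c\<close> is that of the gap before the
  leftmost leg taken so far.
\<close>

fun close_from :: "'u \<Rightarrow> nat \<Rightarrow> ('c \<Rightarrow> ('u \<times> 'c) list \<Rightarrow> complex) \<Rightarrow> 'c \<Rightarrow> ('u \<times> 'c) list \<Rightarrow> complex"
where
  "close_from v m F c [] = r v (Suc m) * F c []"
| "close_from v m F c ((v', c') # st) =
     r v (Suc m) * F c ((v', c') # st) + (if v' = v then close_from v (Suc m) F c' st else 0)"

definition op_Y :: "'u \<Rightarrow> ('c \<Rightarrow> ('u \<times> 'c) list \<Rightarrow> complex) \<Rightarrow> 'c \<Rightarrow> ('u \<times> 'c) list \<Rightarrow> complex" where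
  "op_Y v F c st = (\<Sum>g\<in>C. d g * F g ((v, c) # st)) + close_from v 0 F c st"

definition op_D :: "'c \<Rightarrow> ('c \<Rightarrow> ('u \<times> 'c) list \<Rightarrow> complex) \<Rightarrow> 'c \<Rightarrow> ('u \<times> 'c) list \<Rightarrow> complex" where
  "op_D j F c st = (if c = j then F c st else 0)"

definition vac :: "'c \<Rightarrow> ('u \<times> 'c) list \<Rightarrow> complex" where
  "vac c st = (if st = [] then 1 else 0)"

definition vac_state :: "('c \<Rightarrow> ('u \<times> 'c) list \<Rightarrow> complex) \<Rightarrow> complex" where
  "vac_state F = (\<Sum>c\<in>C. d c * F c [])"

definition op_letter :: "'u + 'c \<Rightarrow> ('c \<Rightarrow> ('u \<times> 'c) list \<Rightarrow> complex) \<Rightarrow> 'c \<Rightarrow> ('u \<times> 'c) list \<Rightarrow> complex"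
  where "op_letter = case_sum op_Y op_D"

text \<open>
  The same operators without colours.  They compute the coefficients, indexed by words in the
  labels, with which a product of the \<open>op_Y v\<close> creates out of the vacuum.
\<close>

fun close_coef :: "'u \<Rightarrow> nat \<Rightarrow> ('u list \<Rightarrow> complex) \<Rightarrow> 'u list \<Rightarrow> complex" where
  "close_coef v m a [] = r v (Suc m) * a []"
| "close_coef v m a (v' # x) =
     r v (Suc m) * a (v' # x) + (if v' = v then close_coef v (Suc m) a x else 0)"

definition coef_Y :: "'u \<Rightarrow> ('u list \<Rightarrow> complex) \<Rightarrow> 'u list \<Rightarrow> complex" where
  "coef_Y v a x = a (v # x) + close_coef v 0 a x"

definition coef :: "'u list \<Rightarrow> 'u list \<Rightarrow> complex" where
  "coef w = foldr coef_Y w (\<lambda>x. if x = [] then 1 else 0)"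

text \<open>
  The action of \<open>\<Sum>\<^sub>x a(x) l\<^sub>x\<close>, where \<open>l\<^sub>x\<close> is the product of the creation operators with the labels in
  \<open>x\<close>: evaluated at a stack, it is the sum over all ways to cut off an initial segment with
  labels \<open>x\<close>.
\<close>

fun create :: "('u list \<Rightarrow> complex) \<Rightarrow> ('c \<Rightarrow> ('u \<times> 'c) list \<Rightarrow> complex) \<Rightarrow> 'c \<Rightarrow> ('u \<times> 'c) list \<Rightarrow> complex"
where
  "create a F c [] = a [] * F c []"
| "create a F c ((v, c') # st) = a [] * F c ((v, c') # st) + create (\<lambda>x. a (v # x)) F c' st"

text \<open>
  The common kernel of the annihilation operators with labels in \<open>L\<close>.
\<close>

definition annihilated :: "'u set \<Rightarrow> ('c \<Rightarrow> ('u \<times> 'c) list \<Rightarrow> complex) \<Rightarrow> bool" where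
  "annihilated L F \<longleftrightarrow> (\<forall>v\<in>L. \<forall>c st. (\<Sum>g\<in>C. d g * F g ((v, c) # st)) = 0)"

lemma create_add: "create (\<lambda>x. a x + b x) F c st = create a F c st + create b F c st"
proof (induction st arbitrary: a b c)
  case (Cons p st)
  then show ?case by (cases p) (simp add: distrib_right)
qed (simp add: distrib_right)

lemma create_cmult: "create (\<lambda>x. k * a x) F c st = k * create a F c st"
  by (induction a F c st rule: create.induct) (simp_all add: algebra_simps)

lemma create_zero [simp]: "create (\<lambda>x. 0) F c st = 0"
  using create_cmult[of 0 "\<lambda>_. 0"] by simp

lemma create_unit: "create (\<lambda>x. if x = [] then 1 else 0) F c st = F c st"
  by (cases st) auto

lemma create_nc_functional:
  "create (\<lambda>x. nc_functional (\<lambda>w. A w x) f) F c st = nc_functional (\<lambda>w. create (A w) F c st) f"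
proof (induction st arbitrary: A c)
  case Nil
  then show ?case by (simp add: nc_functional_cmult_right)
next
  case (Cons p st)
  then show ?case
    by (cases p) (simp add: nc_functional_cmult_right nc_functional_plus)
qed

lemma close_from_create: "close_from v m (create a F) c st = create (close_coef v m a) F c st"
proof (induction st arbitrary: m c)
  case Nil
  then show ?case by simp
next
  case (Cons p st)
  then show ?case
    by (cases p) (simp add: create_add create_cmult ring_distribs mult.assoc)
qed

text \<open>
  On the kernel of the annihilation operators, annihilating after creating only shortens the
  created word: the colours decouple because their weights sum to one.
\<close>

lemma op_Y_create:
  assumes "annihilated L F" "v \<in> L"
  shows "op_Y v (create a F) = create (coef_Y v a) F"
proof (intro ext)
  fix c st
  have "(\<Sum>g\<in>C. d g * create a F g ((v, c) # st)) =
      a [] * (\<Sum>g\<in>C. d g * F g ((v, c) # st)) + (\<Sum>g\<in>C. d g) * create (\<lambda>x. a (v # x)) F c st"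
    by (simp add: sum.distrib sum_distrib_left sum_distrib_right algebra_simps)
  also have "\<dots> = create (\<lambda>x. a (v # x)) F c st"
    using assms by (simp add: annihilated_def sum_d)
  finally have "op_Y v (create a F) c st = create (\<lambda>x. a (v # x) + close_coef v 0 a x) F c st"
    by (simp add: op_Y_def close_from_create create_add)
  then show "op_Y v (create a F) c st = create (coef_Y v a) F c st"
    by (simp add: coef_Y_def[abs_def])
qed

text \<open>
  The key computation: up to creation operators, words in the \<open>Y(v)\<close> act on every vector of the
  kernel as they act on the vacuum.
\<close>

lemma foldr_op_Y:
  assumes "annihilated L F" "set w \<subseteq> L"
  shows "foldr op_Y w F = create (coef w) F"
  using assms(2)
proof (induction w)
  case Nil
  show ?case by (simp add: coef_def create_unit fun_eq_iff)
next
  case (Cons v w)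
  then have "foldr op_Y (v # w) F = op_Y v (create (coef w) F)" by simp
  also have "\<dots> = create (coef (v # w)) F"
    using Cons.prems by (simp add: op_Y_create[OF assms(1)] coef_def)
  finally show ?case .
qed

lemma close_coef_support:
  assumes "\<And>x. \<not> set x \<subseteq> L \<Longrightarrow> a x = 0" "\<not> set x \<subseteq> L" "v \<in> L"
  shows "close_coef v m a x = 0"
  using assms(2)
proof (induction x arbitrary: m)
  case (Cons v' x)
  then show ?case using assms(1)[of "v' # x"] assms(3) by auto
qed simp

lemma coef_support:
  assumes "set w \<subseteq> L" "\<not> set x \<subseteq> L"
  shows "coef w x = 0"
  using assms
proof (induction w arbitrary: x)
  case Nil
  then show ?case by (auto simp: coef_def)
next
  case (Cons v w)
  have "coef (v # w) x = coef w (v # x) + close_coef v 0 (coef w) x"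
    by (simp add: coef_def coef_Y_def)
  also have "\<dots> = 0"
    using Cons close_coef_support[of L "coef w" x v 0] by auto
  finally show ?case .
qed

lemma annihilated_vac: "annihilated L vac"
  by (simp add: annihilated_def vac_def)

lemma vac_state_foldr_op_Y: "vac_state (foldr op_Y w vac) = coef w []"
  unfolding foldr_op_Y[OF annihilated_vac subset_refl]
  by (simp add: vac_state_def vac_def sum_distrib_left[symmetric] sum_distrib_right[symmetric] sum_d)

definition poly_op ::
  "('i \<Rightarrow> ('c \<Rightarrow> ('u \<times> 'c) list \<Rightarrow> complex) \<Rightarrow> 'c \<Rightarrow> ('u \<times> 'c) list \<Rightarrow> complex) \<Rightarrow> 'i ncpoly \<Rightarrow>
   ('c \<Rightarrow> ('u \<times> 'c) list \<Rightarrow> complex) \<Rightarrow> 'c \<Rightarrow> ('u \<times> 'c) list \<Rightarrow> complex" where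
  "poly_op T f F c st = nc_functional (\<lambda>w. foldr T w F c st) f"

text \<open>
  Compatibility with the finite linear combinations that are encoded by \<open>nc_functional\<close>.  The
  \<open>itself\<close> argument fixes the type of indeterminates of the polynomials.
\<close>

definition linear_op :: "(('c \<Rightarrow> ('u \<times> 'c) list \<Rightarrow> complex) \<Rightarrow> 'c \<Rightarrow> ('u \<times> 'c) list \<Rightarrow> complex) \<Rightarrow> 'i itself \<Rightarrow> bool"
  where
  "linear_op T i \<longleftrightarrow> (\<forall>(G :: 'i list \<Rightarrow> _) f. T (\<lambda>c st. nc_functional (\<lambda>w. G w c st) f) =
      (\<lambda>c st. nc_functional (\<lambda>w. T (G w) c st) f))"

lemma close_from_nc_functional:
  "close_from v m (\<lambda>c st. nc_functional (\<lambda>w. G w c st) f) c st =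
     nc_functional (\<lambda>w. close_from v m (G w) c st) f"
proof (induction st arbitrary: m c)
  case Nil
  then show ?case by (simp add: nc_functional_cmult)
next
  case (Cons p st)
  have zero: "nc_functional (\<lambda>w. 0) f = 0" by (simp add: nc_functional_def)
  show ?case
    using Cons by (cases p) (simp add: nc_functional_cmult nc_functional_plus zero)
qed

lemma linear_op_Y: "linear_op (op_Y v) i"
  unfolding linear_op_def op_Y_def[abs_def]
  by (simp add: close_from_nc_functional nc_functional_plus nc_functional_sum_left nc_functional_cmult)

lemma linear_op_D: "linear_op (op_D j) i"
proof -
  have zero: "nc_functional (\<lambda>w. 0) f = 0" for f :: "'i ncpoly" by (simp add: nc_functional_def)
  show ?thesis unfolding linear_op_def op_D_def[abs_def] by (simp add: fun_eq_iff zero)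
qed

lemma linear_op_letter: "linear_op (op_letter l) i"
  by (cases l) (simp_all add: op_letter_def linear_op_Y linear_op_D)

lemma foldr_nc_functional:
  fixes T :: "'j \<Rightarrow> ('c \<Rightarrow> ('u \<times> 'c) list \<Rightarrow> complex) \<Rightarrow> 'c \<Rightarrow> ('u \<times> 'c) list \<Rightarrow> complex"
    and G :: "'i list \<Rightarrow> _"
  assumes "\<And>l. linear_op (T l) TYPE('i)"
  shows "foldr T v (\<lambda>c st. nc_functional (\<lambda>w. G w c st) f) =
    (\<lambda>c st. nc_functional (\<lambda>w. foldr T v (G w) c st) f)"
proof (induction v)
  case (Cons l v)
  show ?case
    using assms[of l, unfolded linear_op_def, rule_format, of "\<lambda>w. foldr T v (G w)" f] Cons
    by simp
qed simp

lemma poly_op_mult: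
  fixes T :: "'i \<Rightarrow> ('c \<Rightarrow> ('u \<times> 'c) list \<Rightarrow> complex) \<Rightarrow> 'c \<Rightarrow> ('u \<times> 'c) list \<Rightarrow> complex"
  assumes "\<And>l. linear_op (T l) TYPE('i)"
  shows "poly_op T (f * g) F = poly_op T f (poly_op T g F)"
  using foldr_nc_functional[of T, OF assms, where G = "\<lambda>w. foldr T w F" and f = g]
  by (simp add: fun_eq_iff poly_op_def[abs_def] nc_functional_mult)

lemma poly_op_prod_list:
  fixes T :: "'i \<Rightarrow> ('c \<Rightarrow> ('u \<times> 'c) list \<Rightarrow> complex) \<Rightarrow> 'c \<Rightarrow> ('u \<times> 'c) list \<Rightarrow> complex"
  assumes "\<And>l. linear_op (T l) TYPE('i)"
  shows "poly_op T (prod_list fs) F = foldr (poly_op T) fs F"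
proof (induction fs)
  case Nil
  then show ?case by (simp add: poly_op_def fun_eq_iff)
qed (simp add: poly_op_mult[OF assms])

lemma nc_functional_vac_state:
  "nc_functional (\<lambda>w. vac_state (foldr T w F)) f = vac_state (poly_op T f F)"
  by (simp add: vac_state_def poly_op_def nc_functional_sum_left nc_functional_cmult)

text \<open>
  A centred polynomial in \<open>Y(v)\<close> alone maps a vector without components that start with \<open>v\<close> to one
  in which every component starts with \<open>v\<close>, because it acts by a combination of \<open>l\<^sub>v\<^sup>k\<close> with
  \<open>k \<ge> 1\<close>.  The next factor has another label, so its annihilation operator vanishes on the result;
  at the end no vacuum component is left.
\<close>

lemma free_wrt_op_Y:
  "free_wrt (nc_functional (\<lambda>w. vac_state (foldr op_Y w vac))) ((\<lambda>v. {v}) ` U)"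
  unfolding free_wrt_def
proof (intro allI impI, elim conjE)
  fix Gs :: "'u set list" and fs :: "'u ncpoly list"
  assume Gs: "Gs \<noteq> []" "set Gs \<subseteq> (\<lambda>v. {v}) ` U" "distinct_adj Gs" "length fs = length Gs"
    and "\<forall>i<length Gs. fs ! i \<in> nc_subalgebra (Gs ! i) \<and>
      nc_functional (\<lambda>w. vac_state (foldr op_Y w vac)) (fs ! i) = 0"
  then have "list_all2 (\<lambda>f G. f \<in> nc_subalgebra G \<and> nc_functional (\<lambda>w. coef w []) f = 0) fs Gs"
    by (simp add: list_all2_conv_all_nth vac_state_foldr_op_Y)
  then have "(\<forall>c. foldr (poly_op op_Y) fs vac c [] = 0) \<and>
      (\<forall>v. v \<notin> hd Gs \<longrightarrow> (\<forall>g c st. foldr (poly_op op_Y) fs vac g ((v, c) # st) = 0))"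
    using Gs
  proof (induction fs Gs rule: list_all2_induct)
    case Nil
    then show ?case by simp
  next
    case (Cons f fs G Gs)
    define F where "F = foldr (poly_op op_Y) fs vac"
    obtain v where G: "G = {v}" using Cons.prems(2) by auto
    have F: "annihilated {v} F"
    proof (cases "Gs = []")
      case True
      then have "fs = []" using Cons.hyps(2) by simp
      then show ?thesis by (simp add: F_def annihilated_vac)
    next
      case False
      then have "hd Gs \<noteq> {v}" "distinct_adj Gs"
        using Cons.prems(3) G by (auto simp: distinct_adj_Cons)
      moreover obtain v' where "hd Gs = {v'}"
        using Cons.prems(2) hd_in_set[OF False] by (metis image_iff list.set_intros(2) subsetD)
      ultimately have "v \<notin> hd Gs" by auto
      then show ?thesis
        using Cons.IH Cons.prems(2,4) False \<open>distinct_adj Gs\<close>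
        by (simp add: annihilated_def F_def)
    qed
    define a where "a x = nc_functional (\<lambda>w. coef w x) f" for x
    have "poly_op op_Y f F c st = nc_functional (\<lambda>w. create (coef w) F c st) f" for c st
      unfolding poly_op_def using Cons.hyps(1) G
      by (intro nc_functional_cong[of f "{v}"]) (simp_all add: foldr_op_Y[OF F])
    then have *: "poly_op op_Y f F c st = create a F c st" for c st
      by (simp add: a_def[abs_def] create_nc_functional)
    have a0: "a [] = 0" using Cons.hyps(1) by (simp add: a_def)
    have a1: "a (v' # x) = 0" if "v' \<noteq> v" for v' x
    proof -
      have "a (v' # x) = nc_functional (\<lambda>w. 0) f"
        unfolding a_def using Cons.hyps(1) G that
        by (intro nc_functional_cong[of f "{v}"]) (auto intro!: coef_support)
      then show ?thesis by (simp add: nc_functional_def)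
    qed
    show ?case
      using a0 a1 by (auto simp: F_def[symmetric] * G)
  qed
  then show "nc_functional (\<lambda>w. vac_state (foldr op_Y w vac)) (prod_list fs) = 0"
    unfolding nc_functional_vac_state poly_op_prod_list[OF linear_op_Y]
    by (simp add: vac_state_def)
qed

lemma foldr_op_letter_Inl: "foldr op_letter (map Inl w) F = foldr op_Y w F"
  by (induction w) (simp_all add: op_letter_def)

lemma foldr_op_letter_Inr:
  assumes "set w \<subseteq> range Inr"
  shows "foldr op_letter w F c st = (if set w \<subseteq> {Inr c} then F c st else 0)"
  using assms by (induction w) (auto simp: op_letter_def op_D_def split: if_splits)

lemma vac_state_foldr_Inr:
  assumes "set w \<subseteq> range Inr"
  shows "vac_state (foldr op_letter w vac) = (\<Sum>c | c \<in> C \<and> set w \<subseteq> {Inr c}. d c)"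
  using finite_colours
  by (simp add: vac_state_def foldr_op_letter_Inr[OF assms] vac_def sum.If_cases if_distrib[of "\<lambda>x. _ * x"]
      Int_def cong: if_cong)

text \<open>
  A centred polynomial in the \<open>Y(v)\<close> turns a vector of the kernel into one that does not depend on
  the colour and has no vacuum component.  A polynomial in the \<open>D\<^sub>j\<close> is multiplication by a function
  \<open>e\<close> of the colour with expectation \<open>\<Sum>\<^sub>c d\<^sub>c e(c)\<close>; if this is zero, a vector that does not depend on
  the colour is mapped into the kernel with vacuum expectation zero, because annihilation and
  vacuum expectation average over the colour.  So the two kinds of factors can alternate, starting
  with the vacuum, which is in the kernel and does not depend on the colour.
\<close>

lemma free_wrt_op_letter:
  "free_wrt (nc_functional (\<lambda>w. vac_state (foldr op_letter w vac))) {Inl ` U, Inr ` C}"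
  unfolding free_wrt_def
proof (intro allI impI, elim conjE)
  fix Gs :: "('u + 'c) set list" and fs :: "('u + 'c) ncpoly list"
  assume Gs: "Gs \<noteq> []" "set Gs \<subseteq> {Inl ` U, Inr ` C}" "distinct_adj Gs" "length fs = length Gs"
    and "\<forall>i<length Gs. fs ! i \<in> nc_subalgebra (Gs ! i) \<and>
      nc_functional (\<lambda>w. vac_state (foldr op_letter w vac)) (fs ! i) = 0"
  then have "list_all2 (\<lambda>f G. f \<in> nc_subalgebra G \<and> vac_state (poly_op op_letter f vac) = 0) fs Gs"
    by (simp add: list_all2_conv_all_nth nc_functional_vac_state)
  then have "(Gs \<noteq> [] \<longrightarrow> vac_state (foldr (poly_op op_letter) fs vac) = 0) \<and>
      (hd Gs = Inl ` U \<or> Gs = [] \<longrightarrow> (\<forall>c c' st.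
          foldr (poly_op op_letter) fs vac c st = foldr (poly_op op_letter) fs vac c' st)) \<and>
      (hd Gs = Inr ` C \<or> Gs = [] \<longrightarrow> annihilated UNIV (foldr (poly_op op_letter) fs vac))"
    using Gs(2,3)
  proof (induction fs Gs rule: list_all2_induct)
    case Nil
    then show ?case by (simp add: annihilated_vac) (simp add: vac_def)
  next
    case (Cons f fs G Gs)
    define F where "F = foldr (poly_op op_letter) fs vac"
    have ne: "Inl ` U \<noteq> Inr ` C"
      using sum_d by (cases "C = {}") auto
    have dist: "distinct_adj Gs" using Cons.prems(2) by (auto simp: distinct_adj_Cons)
    have hd: "Gs = [] \<or> hd Gs \<in> {Inl ` U, Inr ` C} \<and> hd Gs \<noteq> G"
      using Cons.prems by (cases Gs) (auto simp: distinct_adj_Cons)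
    note IH = Cons.IH[OF _ dist, folded F_def]
    consider "G = Inl ` U" | "G = Inr ` C" using Cons.prems by auto
    then show ?case
    proof cases
      case 1
      have F: "annihilated UNIV F" using IH hd Cons.prems 1 by auto
      define a where "a x = nc_functional (\<lambda>w. coef (map projl w) x) f" for x
      have poly_op_f: "poly_op op_letter f H c st = create a H c st" if "annihilated UNIV H" for H c st
      proof -
        have "poly_op op_letter f H c st = nc_functional (\<lambda>w. create (coef (map projl w)) H c st) f"
          unfolding poly_op_def
        proof (rule nc_functional_cong[of f G])
          fix w assume w: "set w \<subseteq> G"
          then have "map Inl (map projl w) = w"
            unfolding map_map by (intro map_idI) (use w 1 in auto)
          then show "foldr op_letter w H c st = create (coef (map projl w)) H c st"
            using foldr_op_letter_Inl[of "map projl w" H] foldr_op_Y[OF that, of "map projl w"] by simp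
        qed (use Cons.hyps(1) in simp)
        then show ?thesis by (simp add: a_def[abs_def] create_nc_functional)
      qed
      have a0: "a [] = 0"
        using Cons.hyps(1) poly_op_f[OF annihilated_vac]
        by (simp add: vac_state_def vac_def sum_distrib_right[symmetric] sum_d)
      have "create a F c st = create a F c' st" for c c' st
        using a0 by (cases st) auto
      moreover have "vac_state (create a F) = 0" by (simp add: vac_state_def a0)
      moreover have "poly_op op_letter f F = create a F" by (simp add: fun_eq_iff poly_op_f[OF F])
      ultimately show ?thesis using 1 ne by (simp add: F_def[symmetric])
    next
      case 2
      have F: "F c st = F c' st" for c c' st using IH hd Cons.prems 2 by auto
      define e where "e c = nc_functional (\<lambda>w. if set w \<subseteq> {Inr c} then 1 else 0) f" for c
      have poly_op_f: "poly_op op_letter f H c st = e c * H c st" for H c st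
        unfolding poly_op_def e_def nc_functional_cmult_right[symmetric]
      proof (rule nc_functional_cong[of f G])
        fix w assume "set w \<subseteq> G"
        then have "set w \<subseteq> range Inr" using 2 by auto
        then show "foldr op_letter w H c st = (if set w \<subseteq> {Inr c} then 1 else 0) * H c st"
          by (simp add: foldr_op_letter_Inr)
      qed (use Cons.hyps(1) in simp)
      have e: "(\<Sum>c\<in>C. d c * e c) = 0"
        using Cons.hyps(1) by (simp add: poly_op_f vac_state_def vac_def)
      have *: "(\<Sum>g\<in>C. d g * (e g * F g st)) = 0" for st
      proof -
        obtain K where "\<And>g. F g st = K" using F by metis
        then have "(\<Sum>g\<in>C. d g * (e g * F g st)) = (\<Sum>g\<in>C. d g * e g) * K"
          by (simp add: sum_distrib_right mult.assoc)
        then show ?thesis using e by simp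
      qed
      then show ?thesis
        using 2 ne by (auto simp: F_def[symmetric] poly_op_f vac_state_def annihilated_def)
    qed
  qed
  then show "nc_functional (\<lambda>w. vac_state (foldr op_letter w vac)) (prod_list fs) = 0"
    unfolding nc_functional_vac_state poly_op_prod_list[OF linear_op_letter]
    using Gs(1) by simp
qed

end

section \<open>Moments in the Fock space and noncrossing partitions\<close>

lemma close_coef_replicate:
  "fock_model.close_coef r v m a (replicate n v) =
     (\<Sum>k\<le>n. r v (Suc (m + k)) * a (replicate (n - k) v))"
  if "fock_model C d"
proof -
  interpret fock_model C d r by fact
  show ?thesis
  proof (induction n arbitrary: m)
    case (Suc n)
    then show ?case by (simp add: sum.atMost_Suc_shift del: sum.atMost_Suc)
  qed simp
qed

context fock_model
begin

lemma close_from_eq_sum: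
  "close_from v m F c st = (\<Sum>k\<le>length st. if \<forall>p\<in>set (take k st). fst p = v
     then r v (Suc (m + k)) * F (if k = 0 then c else snd (st ! (k - 1))) (drop k st) else 0)"
proof (induction st arbitrary: m c)
  case Nil
  then show ?case by simp
next
  case (Cons p st)
  obtain v' c' where p: "p = (v', c')" by force
  show ?case
    unfolding p close_from.simps Cons.IH length_Cons sum.atMost_Suc_shift
    by (cases "v' = v") (auto intro!: sum.cong simp: nth_Cons')
qed

text \<open>
  With a single label and no colours, the recursions for partitions and for the model agree, so the
  \<open>m\<close>-th moment of the model variable with label \<open>v\<close> is given by the moment-cumulant formula for
  \<open>r v\<close>.
\<close>

lemma nc_sum_eq_coef:
  assumes "sorted_wrt (>) st" "sorted_wrt (<) ss"
    and "\<And>a b. a \<in> set st \<Longrightarrow> b \<in> set ss \<Longrightarrow> a < b"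
  shows "nc_sum (\<lambda>V. r v (card V)) st ss = coef (replicate (length ss) v) (replicate (length st) v)"
  using assms
proof (induction ss arbitrary: st)
  case Nil
  then show ?case by (simp add: coef_def)
next
  case (Cons s ss)
  have card: "card (insert s (set (take k st))) = Suc k" if "k \<le> length st" for k
  proof -
    have "distinct st" using Cons.prems(1) by (metis distinct_rev sorted_wrt_rev strict_sorted_iff)
    moreover have "s \<notin> set (take k st)" using Cons.prems(3)[of s s] by (auto dest: in_set_takeD)
    ultimately show ?thesis using that by (simp add: distinct_card)
  qed
  have "nc_sum (\<lambda>V. r v (card V)) st (s # ss) = nc_sum (\<lambda>V. r v (card V)) (s # st) ss +
     (\<Sum>k\<le>length st. r v (card (insert s (set (take k st)))) * nc_sum (\<lambda>V. r v (card V)) (drop k st) ss)"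
    by (rule nc_sum_Cons) (use Cons.prems in auto)
  also have "nc_sum (\<lambda>V. r v (card V)) (s # st) ss
      = coef (replicate (length ss) v) (v # replicate (length st) v)"
    using Cons.prems by (subst Cons.IH) auto
  also have "(\<Sum>k\<le>length st. r v (card (insert s (set (take k st)))) * nc_sum (\<lambda>V. r v (card V)) (drop k st) ss)
      = (\<Sum>k\<le>length st. r v (Suc (0 + k)) * coef (replicate (length ss) v) (replicate (length st - k) v))"
  proof (rule sum.cong)
    fix k assume "k \<in> {..length st}"
    moreover have "nc_sum (\<lambda>V. r v (card V)) (drop k st) ss =
        coef (replicate (length ss) v) (replicate (length (drop k st)) v)"
      by (rule Cons.IH) (use Cons.prems in \<open>auto simp: sorted_wrt_drop dest: in_set_dropD\<close>)
    ultimately show "r v (card (insert s (set (take k st)))) * nc_sum (\<lambda>V. r v (card V)) (drop k st) ss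
      = r v (Suc (0 + k)) * coef (replicate (length ss) v) (replicate (length st - k) v)"
      using card by simp
  qed simp
  finally show ?case
    by (simp add: coef_def coef_Y_def close_coef_replicate[OF fock_model_axioms])
qed

end

lemma NC_eq_nc_partitions: "NC N = nc_partitions {1..N}"
  by (simp add: NC_def nc_partitions_def)

lemma nc_sum_NC: "nc_sum wt [] [1..<Suc N] = (\<Sum>\<pi>\<in>NC N. \<Prod>V\<in>\<pi>. wt V)"
proof -
  have "{\<pi> \<in> nc_partitions {1..N}. \<forall>V\<in>\<pi>. \<not> V \<subseteq> {}} = NC N"
    unfolding NC_eq_nc_partitions by (auto simp: nc_partitions_def partition_on_def)
  moreover have "set [] \<union> set [1..<Suc N] = {1..N}" by auto
  ultimately show ?thesis unfolding nc_sum_def by simp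
qed

lemma block_succ_nth:
  assumes "sorted_wrt (>) xs" "Suc i < length xs"
  shows "block_succ (set xs) (xs ! Suc i) = xs ! i"
proof -
  have nth_less: "xs ! k < xs ! j \<longleftrightarrow> j < k" if "j < length xs" "k < length xs" for j k
    using sorted_wrt_nth_less[OF assms(1)] that by (metis linorder_neqE_nat order_less_asym)
  have "Min {t \<in> set xs. xs ! Suc i < t} = xs ! i"
  proof (rule Min_eqI)
    fix t assume "t \<in> {t \<in> set xs. xs ! Suc i < t}"
    then obtain j where "j < length xs" "t = xs ! j" "j < Suc i"
      using nth_less assms(2) by (auto simp: in_set_conv_nth)
    then show "xs ! i \<le> t" using nth_less[of j i] assms(2) by (cases "j = i") auto
  qed (use nth_less assms(2) in auto)
  moreover have "\<exists>t\<in>set xs. xs ! Suc i < t"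
    using nth_less assms(2) by (intro bexI[of _ "xs ! i"]) auto
  ultimately show ?thesis by (simp add: block_succ_def)
qed

lemma block_succ_Max:
  assumes "sorted_wrt (>) (x # xs)"
  shows "block_succ (set (x # xs)) x = last (x # xs)"
proof -
  have "Min (set (x # xs)) = last (x # xs)"
  proof (rule Min_eqI)
    obtain ys y where xs: "x # xs = ys @ [y]" by (metis list.distinct(2) rev_exhaust)
    show "last (x # xs) \<le> t" if "t \<in> set (x # xs)" for t
      using assms that unfolding xs by (auto simp: sorted_wrt_append intro: less_imp_le)
  qed auto
  moreover have "\<not> (\<exists>t\<in>set (x # xs). x < t)" using assms by auto
  ultimately show ?thesis unfolding block_succ_def by (simp only: if_False)
qed

text \<open>
  A word in which each leg \<open>s\<close> is a letter \<open>Y(lab s)\<close> between two projections, which fix the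
  colours \<open>before s\<close> and \<open>after s\<close> of the adjacent gaps.
\<close>

locale coloured_legs = fock_model C d r for C :: "'c set" and d and r :: "'u \<Rightarrow> nat \<Rightarrow> complex" +
  fixes lab :: "nat \<Rightarrow> 'u" and before after :: "nat \<Rightarrow> 'c"
begin

text \<open>
  The waiting legs, read from the top of the stack, when the current gap has colour \<open>c\<close>: between two
  consecutive waiting legs only complete blocks have been read, and these return to the colour from
  which they started.
\<close>

fun chain :: "'c \<Rightarrow> nat list \<Rightarrow> bool" where
  "chain c [] \<longleftrightarrow> True"
| "chain c (t # st) \<longleftrightarrow> after t = c \<and> chain (before t) st"

fun path :: "'c \<Rightarrow> nat list \<Rightarrow> bool" where
  "path c [] \<longleftrightarrow> True"
| "path c (s # ss) \<longleftrightarrow> before s = c \<and> path (after s) ss"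

definition leg_weight :: "nat set \<Rightarrow> complex" where
  "leg_weight V =
     (if (\<forall>s\<in>V. \<forall>t\<in>V. lab s = lab t) \<and> (\<forall>s\<in>V. after s = before (block_succ V s))
      then (\<Prod>s\<in>V - {Max V}. d (after s)) * r (lab (Min V)) (card V) else 0)"

definition leg_word :: "nat list \<Rightarrow> ('u + 'c) list" where
  "leg_word ss = concat (map (\<lambda>s. [Inr (before s), Inl (lab s), Inr (after s)]) ss)"

lemma chain_nth: "chain c xs \<Longrightarrow> i < length xs \<Longrightarrow> after (xs ! i) = (if i = 0 then c else before (xs ! (i - 1)))"
proof (induction xs arbitrary: c i)
  case (Cons x xs)
  then show ?case by (cases i) (auto simp: nth_Cons split: nat.splits)
qed simp

lemma chain_drop:
  "chain c xs \<Longrightarrow> k \<le> length xs \<Longrightarrow> chain (if k = 0 then c else before (xs ! (k - 1))) (drop k xs)"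
proof (induction xs arbitrary: c k)
  case (Cons x xs)
  show ?case
  proof (cases k)
    case (Suc j)
    then show ?thesis using Cons.IH[of "before x" j] Cons.prems by (cases j) auto
  qed (use Cons.prems in simp)
qed simp

lemma chain_take: "chain c xs \<Longrightarrow> chain c (take k xs)"
proof (induction xs arbitrary: c k)
  case (Cons x xs)
  then show ?case by (cases k) auto
qed simp

text \<open>
  For a block that consists of \<open>x\<close> and the top of the stack, \<open>chain\<close> already contains the colour
  conditions between consecutive legs.  The condition that is left is the one that closes the cycle
  from the last leg \<open>x\<close> to the first.
\<close>

lemma coloured_block_iff:
  assumes "sorted_wrt (>) (x # xs)" "chain (before x) xs"
  shows "(\<forall>t\<in>set (x # xs). after t = before (block_succ (set (x # xs)) t)) \<longleftrightarrow>
     after x = before (last (x # xs))"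
proof -
  have "after t = before (block_succ (set (x # xs)) t)" if t: "t \<in> set xs" for t
  proof -
    obtain i where i: "i < length xs" "t = xs ! i" using t by (auto simp: in_set_conv_nth)
    have "block_succ (set (x # xs)) ((x # xs) ! Suc i) = (x # xs) ! i"
      by (rule block_succ_nth) (use assms i in auto)
    then show ?thesis using chain_nth[OF assms(2) i(1)] i by (cases i) auto
  qed
  then show ?thesis using block_succ_Max[OF assms(1)] by auto
qed

text \<open>
  The model pays the dimension factor of a leg when the leg starts to wait, the weight of a block
  contains it when the block is complete.  The product on the right corrects for the legs that
  still wait.
\<close>

lemma nc_sum_eq_foldr:
  assumes "sorted_wrt (>) st" "sorted_wrt (<) ss"
    and "\<And>a b. a \<in> set st \<Longrightarrow> b \<in> set ss \<Longrightarrow> a < b"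
    and "chain c st" "path c ss" "after ` set ss \<subseteq> C"
  shows "nc_sum leg_weight st ss = (\<Prod>t\<in>set st. d (after t)) *
     foldr op_letter (leg_word ss) vac c (map (\<lambda>t. (lab t, before t)) st)"
  using assms
proof (induction ss arbitrary: st c)
  case Nil
  then show ?case by (simp add: leg_word_def vac_def)
next
  case (Cons s ss)
  define F where "F = foldr op_letter (leg_word ss) vac"
  define stk where "stk xs = map (\<lambda>t. (lab t, before t)) xs" for xs
  define D where "D T = (\<Prod>t\<in>T. d (after t))" for T
  define col where "col k = (if k = 0 then c else before (st ! (k - 1)))" for k
  have c: "before s = c" and path: "path (after s) ss" using Cons.prems by auto
  have dist: "distinct st" using Cons.prems(1) by (metis distinct_rev sorted_wrt_rev strict_sorted_iff)
  have less: "t < s" if "t \<in> set st" for t using that Cons.prems(3) by auto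
  have ns: "s \<notin> set st" using less by blast
  have lt: "a < b" if "a \<in> set (s # st)" "b \<in> set ss" for a b
    using that Cons.prems(2,3) by auto
  have push: "nc_sum leg_weight (s # st) ss = D (set st) * (d (after s) * F (after s) (stk (s # st)))"
  proof -
    have "nc_sum leg_weight (s # st) ss = D (set (s # st)) * F (after s) (stk (s # st))"
      unfolding D_def F_def stk_def by (rule Cons.IH[OF _ _ lt]) (use Cons.prems in auto)
    then show ?thesis using ns by (simp add: D_def mult_ac)
  qed
  have close: "leg_weight (insert s (set (take k st))) * nc_sum leg_weight (drop k st) ss =
      D (set st) * (if \<forall>p\<in>set (take k (stk st)). fst p = lab s
        then r (lab s) (Suc (0 + k)) * op_D (after s) F (col k) (drop k (stk st)) else 0)"
    if k: "k \<le> length st" for k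
  proof -
    define V where "V = insert s (set (take k st))"
    have sV: "set (s # take k st) = V" by (simp add: V_def)
    have V_sorted: "sorted_wrt (>) (s # take k st)"
      using Cons.prems(1) less by (auto simp: sorted_wrt_take dest: in_set_takeD)
    have snt: "s \<notin> set (take k st)" using ns by (auto dest: in_set_takeD)
    have "Max V = s" unfolding V_def using less by (intro Max_eqI) (auto dest: in_set_takeD less_imp_le)
    then have Vmax: "V - {Max V} = set (take k st)" using snt by (simp add: V_def)
    have cardV: "card V = Suc k" using k dist snt by (simp add: V_def distinct_card)
    have lab: "(\<forall>x\<in>V. \<forall>y\<in>V. lab x = lab y) \<longleftrightarrow> (\<forall>p\<in>set (take k (stk st)). fst p = lab s)"
      by (auto simp: V_def stk_def take_map)
    have "last (s # take k st) = (if k = 0 then s else st ! (k - 1))"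
      using k by (auto simp: last_conv_nth)
    then have colour: "(\<forall>x\<in>V. after x = before (block_succ V x)) \<longleftrightarrow> after s = col k"
      using coloured_block_iff[OF V_sorted] chain_take[OF Cons.prems(4)] c
      unfolding sV by (simp add: col_def)
    show ?thesis
    proof (cases "(\<forall>p\<in>set (take k (stk st)). fst p = lab s) \<and> after s = col k")
      case True
      have "Min V \<in> V" by (intro Min_in) (auto simp: V_def)
      then have "lab (Min V) = lab s" using True lab by (auto simp: V_def)
      then have "leg_weight V = D (set (take k st)) * r (lab s) (Suc k)"
        unfolding leg_weight_def lab colour Vmax cardV D_def using True by simp
      moreover have "nc_sum leg_weight (drop k st) ss = D (set (drop k st)) * F (after s) (stk (drop k st))"
        unfolding D_def F_def stk_def
      proof (rule Cons.IH)
        show "chain (after s) (drop k st)"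
          using chain_drop[OF Cons.prems(4) k] True by (simp add: col_def)
      qed (use Cons.prems path in \<open>auto simp: sorted_wrt_drop dest: in_set_dropD\<close>)
      moreover have "D (set st) = D (set (take k st)) * D (set (drop k st))"
      proof -
        have "set (take k st) \<inter> set (drop k st) = {}" "set (take k st) \<union> set (drop k st) = set st"
          using dist by (metis append_take_drop_id distinct_append) (metis append_take_drop_id set_append)
        then show ?thesis unfolding D_def using prod.union_disjoint[of "set (take k st)" "set (drop k st)"]
          by simp
      qed
      ultimately show ?thesis
        using True by (simp add: V_def[symmetric] op_D_def stk_def drop_map)
    next
      case False
      then have "leg_weight V = 0" unfolding leg_weight_def lab colour by (simp only: if_False)
      then show ?thesis using False by (auto simp: V_def op_D_def)
    qed
  qed
  have "foldr op_letter (leg_word (s # ss)) vac c (stk st) = op_Y (lab s) (op_D (after s) F) c (stk st)"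
    by (simp add: leg_word_def op_letter_def op_D_def c F_def)
  also have "\<dots> = (\<Sum>g\<in>C. d g * op_D (after s) F g (stk (s # st))) + close_from (lab s) 0 (op_D (after s) F) c (stk st)"
    by (simp add: op_Y_def stk_def c)
  also have "(\<Sum>g\<in>C. d g * op_D (after s) F g (stk (s # st))) = d (after s) * F (after s) (stk (s # st))"
  proof -
    have "(\<Sum>g\<in>C. d g * op_D (after s) F g (stk (s # st)))
        = (\<Sum>g\<in>C. if g = after s then d g * F g (stk (s # st)) else 0)"
      by (intro sum.cong) (auto simp: op_D_def)
    then show ?thesis using finite_colours Cons.prems(6) by (simp add: sum.delta)
  qed
  also have "close_from (lab s) 0 (op_D (after s) F) c (stk st) =
    (\<Sum>k\<le>length st. if \<forall>p\<in>set (take k (stk st)). fst p = lab s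
        then r (lab s) (Suc (0 + k)) * op_D (after s) F (col k) (drop k (stk st)) else 0)"
    unfolding close_from_eq_sum by (rule sum.cong) (auto simp: stk_def col_def)
  finally have "D (set st) * foldr op_letter (leg_word (s # ss)) vac c (stk st) =
      nc_sum leg_weight (s # st) ss +
      (\<Sum>k\<le>length st. leg_weight (insert s (set (take k st))) * nc_sum leg_weight (drop k st) ss)"
    by (simp add: push close distrib_left sum_distrib_left)
  also have "\<dots> = nc_sum leg_weight st (s # ss)"
    by (rule nc_sum_Cons[symmetric]) (use Cons.prems in auto)
  finally show ?case by (simp add: D_def stk_def)
qed

lemma vac_state_leg_word:
  assumes "c \<in> C" "path c [1..<Suc N]" "after ` {1..N} \<subseteq> C"
  shows "vac_state (foldr op_letter (Inr c # leg_word [1..<Suc N]) vac) =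
    d c * (\<Sum>\<pi>\<in>NC N. \<Prod>V\<in>\<pi>. leg_weight V)"
proof -
  define F where "F = foldr op_letter (leg_word [1..<Suc N]) vac"
  have "nc_sum leg_weight [] [1..<Suc N] = (\<Prod>t\<in>set []. d (after t)) *
      foldr op_letter (leg_word [1..<Suc N]) vac c (map (\<lambda>t. (lab t, before t)) [])"
    by (rule nc_sum_eq_foldr) (use assms(2,3) in \<open>auto simp del: upt_Suc\<close>)
  then have *: "F c [] = (\<Sum>\<pi>\<in>NC N. \<Prod>V\<in>\<pi>. leg_weight V)"
    by (simp add: nc_sum_NC[symmetric] F_def del: upt_Suc One_nat_def)
  have "vac_state (foldr op_letter (Inr c # leg_word [1..<Suc N]) vac) = vac_state (op_D c F)"
    by (simp add: op_letter_def F_def del: upt_Suc)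
  also have "\<dots> = (\<Sum>g\<in>C. if g = c then d g * F g [] else 0)"
    unfolding vac_state_def by (intro sum.cong) (auto simp: op_D_def)
  also have "\<dots> = d c * F c []" using finite_colours assms(1) by (simp add: sum.delta)
  finally show ?thesis by (simp add: *)
qed

end

section \<open>Gap colours along the powers of W\<close>

fun before_index :: "letter \<Rightarrow> nat" where
  "before_index (Plain j) = j"
| "before_index (Starred j) = j + 1"

lemma length_W [simp]: "length (W p) = 2 * p"
  by (simp add: W_def)

lemma nth_W:
  assumes "i < 2 * p"
  shows "W p ! i = (if i < p then Plain (i + 1) else Starred (2 * p - i))"
proof (cases "i < p")
  case False
  then have "rev [1..<p + 1] ! (i - p) = [1..<p + 1] ! (p - Suc (i - p))"
    using assms by (subst rev_nth) (auto simp: less_diff_conv2 simp del: upt_Suc)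
  also have "\<dots> = 2 * p - i" using False assms by (subst nth_upt) auto
  finally show ?thesis using False assms by (simp add: W_def nth_append del: upt_Suc)
qed (simp add: W_def nth_append del: upt_Suc)

lemma nth_concat_replicate:
  "i < k * length xs \<Longrightarrow> concat (replicate k xs) ! i = xs ! (i mod length xs)"
proof (induction k arbitrary: i)
  case (Suc k)
  show ?case
  proof (cases "i < length xs")
    case False
    then have "concat (replicate k xs) ! (i - length xs) = xs ! ((i - length xs) mod length xs)"
      using Suc by auto
    then show ?thesis using False by (simp add: nth_append le_mod_geq)
  qed (simp add: nth_append)
qed simp

lemma length_W_pow [simp]: "length (W_pow p k) = 2 * p * k"
  by (simp add: W_pow_def length_concat sum_list_replicate)

lemma leg_color_eq:
  assumes "1 \<le> s" "s \<le> 2 * p * k"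
  shows "leg_color p k s = (let i = (s - 1) mod (2 * p) in if i < p then Plain (i + 1) else Starred (2 * p - i))"
proof -
  have "s - 1 < k * (2 * p)" using assms by (simp add: mult_ac)
  moreover from this have "0 < 2 * p" by (cases p) auto
  ultimately show ?thesis
    using nth_concat_replicate[of "s - 1" k "W p"] nth_W[of "(s - 1) mod (2 * p)" p]
    by (simp add: leg_color_def W_pow_def Let_def)
qed

lemma dvd_small_int:
  fixes x m :: int
  assumes "m > 0" "- m \<le> x" "x < m"
  shows "m dvd x \<longleftrightarrow> x = 0 \<or> x = - m"
proof
  assume "m dvd x"
  then obtain q where q: "x = m * q" by blast
  have "q < 1" using assms q by (metis mult.right_neutral mult_less_cancel_left_pos)
  moreover have "- 1 \<le> q" using assms q by (metis mult.right_neutral mult_le_cancel_left_pos mult_minus_right)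
  ultimately have "q = 0 \<or> q = - 1" by linarith
  then show "x = 0 \<or> x = - m" using q by auto
qed auto

text \<open>
  Let \<open>i\<close> and \<open>j\<close> be the positions of the legs within a period of length \<open>2p\<close>, counted from \<open>0\<close>.  The gaps
  of a period have the colours \<open>1, \<dots>, p+1, p, \<dots>, 1\<close>, so two gaps have the same colour if and only
  if they coincide up to periodicity or are mirror images.  For the gap after \<open>i\<close> and the gap
  before \<open>j\<close> this means \<open>j = i + 1\<close> up to periodicity or \<open>i + j = 2p - 1\<close>.
\<close>

lemma colour_match:
  assumes s: "1 \<le> s" "s \<le> 2 * p * k" and t: "1 \<le> t" "t \<le> 2 * p * k"
  shows "[int t = int s + 1] (mod (2 * int p)) \<or> [int t = 2 * int p - int s + 1] (mod (2 * int p)) \<longleftrightarrow>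
     dim_index (leg_color p k s) = before_index (leg_color p k t)"
proof -
  define i j where "i = (s - 1) mod (2 * p)" and "j = (t - 1) mod (2 * p)"
  have p: "p > 0" using s by (cases p) auto
  have ij: "i < 2 * p" "j < 2 * p" using p by (auto simp: i_def j_def)
  obtain a where si: "int s = int i + 1 + 2 * int p * a"
  proof
    have "s = i + 1 + 2 * p * ((s - 1) div (2 * p))"
      using s(1) mult_div_mod_eq[of "2 * p" "s - 1"] unfolding i_def by linarith
    then have "int s = int (i + 1 + 2 * p * ((s - 1) div (2 * p)))" by (rule arg_cong)
    then show "int s = int i + 1 + 2 * int p * int ((s - 1) div (2 * p))"
      by (simp only: of_nat_add of_nat_mult of_nat_1 of_nat_numeral)
  qed
  obtain b where tj: "int t = int j + 1 + 2 * int p * b"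
  proof
    have "t = j + 1 + 2 * p * ((t - 1) div (2 * p))"
      using t(1) mult_div_mod_eq[of "2 * p" "t - 1"] unfolding j_def by linarith
    then have "int t = int (j + 1 + 2 * p * ((t - 1) div (2 * p)))" by (rule arg_cong)
    then show "int t = int j + 1 + 2 * int p * int ((t - 1) div (2 * p))"
      by (simp only: of_nat_add of_nat_mult of_nat_1 of_nat_numeral)
  qed
  have "[int t = int s + 1] (mod (2 * int p)) \<longleftrightarrow> 2 * int p dvd (int j - int i - 1) + 2 * int p * (b - a)"
    unfolding cong_iff_dvd_diff si tj by (simp add: algebra_simps)
  also have "\<dots> \<longleftrightarrow> 2 * int p dvd (int j - int i - 1)" by (rule dvd_add_left_iff) simp
  also have "\<dots> \<longleftrightarrow> j = i + 1 \<or> (i = 2 * p - 1 \<and> j = 0)"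
    using ij p by (subst dvd_small_int) auto
  finally have 1: "[int t = int s + 1] (mod (2 * int p)) \<longleftrightarrow> j = i + 1 \<or> (i = 2 * p - 1 \<and> j = 0)" .
  have "[int t = 2 * int p - int s + 1] (mod (2 * int p)) \<longleftrightarrow>
      2 * int p dvd (int j + int i + 1 - 2 * int p) + 2 * int p * (b + a)"
    unfolding cong_iff_dvd_diff si tj by (simp add: algebra_simps)
  also have "\<dots> \<longleftrightarrow> 2 * int p dvd (int j + int i + 1 - 2 * int p)" by (rule dvd_add_left_iff) simp
  also have "\<dots> \<longleftrightarrow> i + j + 1 = 2 * p"
    using ij p by (subst dvd_small_int) auto
  finally have 2: "[int t = 2 * int p - int s + 1] (mod (2 * int p)) \<longleftrightarrow> i + j + 1 = 2 * p" .
  show ?thesis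
    unfolding 1 2 leg_color_eq[OF s] leg_color_eq[OF t] Let_def i_def[symmetric] j_def[symmetric]
    using ij by auto
qed

lemma block_succ_in:
  assumes "finite V" "s \<in> V"
  shows "block_succ V s \<in> V"
proof (cases "\<exists>t\<in>V. s < t")
  case True
  then have "Min {t \<in> V. s < t} \<in> {t \<in> V. s < t}" using assms by (intro Min_in) auto
  then show ?thesis using True by (auto simp: block_succ_def)
next
  case False
  then show ?thesis using assms by (auto simp: block_succ_def intro!: Min_in)
qed

definition letter_word :: "(nat \<Rightarrow> 'u) \<Rightarrow> letter \<Rightarrow> ('u + nat) list" where
  "letter_word u x = [Inr (before_index x), Inl (u (letter_index x)), Inr (dim_index x)]"

lemma vac_state_W_pow:
  fixes d :: "nat \<Rightarrow> real" and r :: "'u \<Rightarrow> nat \<Rightarrow> complex" and u :: "nat \<Rightarrow> 'u"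
  assumes p: "1 \<le> p" and fock: "fock_model {1..p+1} (\<lambda>j. of_real (d j))"
  shows "fock_model.vac_state {1..p+1} (\<lambda>j. of_real (d j))
      (foldr (fock_model.op_letter {1..p+1} (\<lambda>j. of_real (d j)) r)
        (Inr 1 # concat (map (letter_word u) (W_pow p k))) fock_model.vac) =
     of_real (d 1) * (\<Sum>\<pi>\<in>NC_W p k u. \<Prod>V\<in>\<pi>. block_weight p k d r u V)"
proof -
  define N where "N = 2 * p * k"
  define bef where "bef s = before_index (leg_color p k s)" for s
  define aft where "aft s = dim_index (leg_color p k s)" for s
  interpret fock_model "{1..p+1}" "\<lambda>j. of_real (d j) :: complex" r by fact
  interpret coloured_legs "{1..p+1}" "\<lambda>j. of_real (d j) :: complex" r "leg_label p k u" bef aft ..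
  have colour: "[int t = int s + 1] (mod (2 * int p)) \<or> [int t = 2 * int p - int s + 1] (mod (2 * int p))
      \<longleftrightarrow> aft s = bef t" if "s \<in> {1..N}" "t \<in> {1..N}" for s t
    using that colour_match[of s p k t] by (simp add: N_def bef_def aft_def)
  have "path c [m..<Suc N]" if "1 \<le> m" "m \<le> N \<Longrightarrow> bef m = c" for m c
    using that
  proof (induction "Suc N - m" arbitrary: m c)
    case (Suc x)
    have "path (aft m) [Suc m..<Suc N]"
    proof (rule Suc.hyps(1))
      show "bef (Suc m) = aft m" if "Suc m \<le> N"
        using colour[of m "Suc m"] that Suc.prems by (simp add: cong_def add.commute)
    qed (use Suc in auto)
    then show ?case using Suc by (simp add: upt_conv_Cons del: upt_Suc)
  qed simp
  moreover have "bef 1 = 1" if "1 \<le> N"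
    using that p by (simp add: bef_def leg_color_eq N_def)
  ultimately have path: "path 1 [1..<Suc N]" by blast
  have aft: "aft ` {1..N} \<subseteq> {1..p+1}"
  proof
    fix x assume "x \<in> aft ` {1..N}"
    then obtain s where s: "1 \<le> s" "s \<le> 2 * p * k" "x = aft s" by (auto simp: N_def)
    have "(s - 1) mod (2 * p) < 2 * p" using p by simp
    then show "x \<in> {1..p+1}" unfolding s(3) aft_def leg_color_eq[OF s(1,2)] Let_def by auto
  qed
  have word: "concat (map (letter_word u) (W_pow p k)) = leg_word [1..<Suc N]"
  proof -
    have "W_pow p k = map (leg_color p k) [1..<Suc N]"
      by (intro nth_equalityI) (simp_all add: N_def leg_color_def del: upt_Suc)
    then show ?thesis
      by (simp add: leg_word_def letter_word_def bef_def aft_def leg_label_def comp_def del: upt_Suc)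
  qed
  define adapted where "adapted V \<longleftrightarrow> (\<forall>s\<in>V. \<forall>t\<in>V. leg_label p k u s = leg_label p k u t) \<and>
      (\<forall>s\<in>V. aft s = bef (block_succ V s))" for V
  have adapted_iff: "\<pi> \<in> NC_W p k u \<longleftrightarrow> (\<forall>V\<in>\<pi>. adapted V)" if \<pi>: "\<pi> \<in> NC N" for \<pi>
  proof -
    have *: "([int (block_succ V s) = int s + 1] (mod (2 * int p)) \<or>
        [int (block_succ V s) = 2 * int p - int s + 1] (mod (2 * int p))) \<longleftrightarrow>
        aft s = bef (block_succ V s)" if "V \<in> \<pi>" "s \<in> V" for V s
    proof (rule colour)
      have "V \<subseteq> {1..N}" using that \<pi> by (auto simp: NC_def partition_on_def)
      then show "s \<in> {1..N}" "block_succ V s \<in> {1..N}"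
        using block_succ_in[OF finite_subset[OF _ finite_atLeastAtMost], of V 1 N s] that by blast+
    qed
    have "color_adapted p \<pi> \<longleftrightarrow> (\<forall>V\<in>\<pi>. \<forall>s\<in>V. aft s = bef (block_succ V s))"
      unfolding color_adapted_def by (intro ball_cong refl *)
    then show ?thesis
      using \<pi> unfolding NC_W_def label_adapted_def adapted_def N_def by blast
  qed
  have weight: "leg_weight V = (if adapted V then block_weight p k d r u V else 0)" for V
    unfolding leg_weight_def adapted_def[symmetric]
    by (simp add: block_weight_def dim_weight_def block_label_def aft_def)
  have "(\<Sum>\<pi>\<in>NC N. \<Prod>V\<in>\<pi>. leg_weight V) = (\<Sum>\<pi>\<in>NC_W p k u. \<Prod>V\<in>\<pi>. block_weight p k d r u V)"
  proof (rule sum.mono_neutral_cong_right)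
    show "finite (NC N)" by (simp add: NC_eq_nc_partitions finite_nc_partitions)
    show sub: "NC_W p k u \<subseteq> NC N" by (auto simp: NC_W_def N_def)
    show "\<forall>\<pi>\<in>NC N - NC_W p k u. (\<Prod>V\<in>\<pi>. leg_weight V) = 0"
    proof
      fix \<pi> assume \<pi>: "\<pi> \<in> NC N - NC_W p k u"
      then obtain V where "V \<in> \<pi>" "\<not> adapted V" using adapted_iff by auto
      moreover have "finite \<pi>"
        using \<pi> finite_elements[OF finite_atLeastAtMost] by (auto simp: NC_def)
      ultimately show "(\<Prod>V\<in>\<pi>. leg_weight V) = 0" by (intro prod_zero) (auto simp: weight)
    qed
    show "(\<Prod>V\<in>\<pi>. leg_weight V) = (\<Prod>V\<in>\<pi>. block_weight p k d r u V)" if "\<pi> \<in> NC_W p k u" for \<pi>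
      using adapted_iff[of \<pi>] sub that by (intro prod.cong) (auto simp: weight)
  qed
  then show ?thesis
    using vac_state_leg_word[of 1 N, OF _ path aft] by (simp only: word) simp
qed

section \<open>Matrix words\<close>

lemma mat_adjoint_index:
  assumes "A \<in> carrier_mat n n" "i < n" "j < n"
  shows "mat_adjoint A $$ (i, j) = cnj (A $$ (j, i))"
  using assms by (simp add: mat_adjoint_def mat_of_rows_index conjugate_complex_def)

lemma mat_adjoint_carrier [simp]: "A \<in> carrier_mat n n \<Longrightarrow> mat_adjoint A \<in> carrier_mat n n"
  by (auto simp: mat_adjoint_def)

lemma mat_adjoint_mult:
  fixes A B :: "complex mat"
  assumes A: "A \<in> carrier_mat n n" and B: "B \<in> carrier_mat n n"
  shows "mat_adjoint (A * B) = mat_adjoint B * mat_adjoint A"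
proof (rule eq_matI)
  fix i j assume "i < dim_row (mat_adjoint B * mat_adjoint A)" "j < dim_col (mat_adjoint B * mat_adjoint A)"
  then have ij: "i < n" "j < n"
    using mat_adjoint_carrier[OF A] mat_adjoint_carrier[OF B] by auto
  have "mat_adjoint (A * B) $$ (i, j) = cnj (\<Sum>k\<in>{0..<n}. A $$ (j, k) * B $$ (k, i))"
    using mat_adjoint_index[of "A * B" n i j] ij A B by (simp add: scalar_prod_def)
  also have "\<dots> = (\<Sum>k\<in>{0..<n}. mat_adjoint B $$ (i, k) * mat_adjoint A $$ (k, j))"
    using ij by (simp add: cnj_sum mat_adjoint_index[OF A] mat_adjoint_index[OF B] mult.commute)
  also have "\<dots> = (mat_adjoint B * mat_adjoint A) $$ (i, j)"
    using ij mat_adjoint_carrier[OF A] mat_adjoint_carrier[OF B] by (simp add: scalar_prod_def)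
  finally show "mat_adjoint (A * B) $$ (i, j) = (mat_adjoint B * mat_adjoint A) $$ (i, j)" .
qed (use mat_adjoint_carrier[OF A] mat_adjoint_carrier[OF B]
    mat_adjoint_carrier[OF mult_carrier_mat[OF A B]] in auto)

lemma mat_prod_carrier [simp]: "set As \<subseteq> carrier_mat n n \<Longrightarrow> mat_prod n As \<in> carrier_mat n n"
  by (induction As) (auto simp: mat_prod_def)

lemma mat_prod_Nil [simp]: "mat_prod n [] = 1\<^sub>m n"
  and mat_prod_Cons [simp]: "mat_prod n (A # As) = A * mat_prod n As"
  by (simp_all add: mat_prod_def)

lemma mat_prod_append:
  assumes "set As \<subseteq> carrier_mat n n" "set Bs \<subseteq> carrier_mat n n"
  shows "mat_prod n (As @ Bs) = mat_prod n As * mat_prod n Bs"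
  using assms(1)
proof (induction As)
  case Nil
  show ?case by (simp add: left_mult_one_mat[OF mat_prod_carrier[OF assms(2)]])
next
  case (Cons A As)
  then show ?case using assms(2) by (simp add: assoc_mult_mat[of _ n n _ n _ n])
qed

lemma mat_prod_concat:
  assumes "\<And>As. As \<in> set Ass \<Longrightarrow> set As \<subseteq> carrier_mat n n"
  shows "mat_prod n (concat Ass) = mat_prod n (map (mat_prod n) Ass)"
  using assms
proof (induction Ass)
  case (Cons As Ass)
  then have "set As \<subseteq> carrier_mat n n" "set (concat Ass) \<subseteq> carrier_mat n n"
    by (simp, simp only: set_concat) (use Cons.prems in auto)
  then show ?case using Cons by (simp add: mat_prod_append)
qed simp

lemma mat_prod_replicate:
  assumes "A \<in> carrier_mat n n"
  shows "mat_prod n (replicate k A) = A ^\<^sub>m k"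
proof (induction k)
  case (Suc k)
  have "mat_prod n (replicate (Suc k) A) = mat_prod n (replicate k A @ [A])"
    by (simp add: replicate_append_same)
  also have "\<dots> = A ^\<^sub>m k * A"
    using assms Suc by (subst mat_prod_append) auto
  finally show ?case by simp
qed (use assms in simp)

lemma mat_adjoint_mat_prod:
  assumes "set As \<subseteq> carrier_mat n n"
  shows "mat_adjoint (mat_prod n As) = mat_prod n (rev (map mat_adjoint As))"
  using assms
proof (induction As)
  case Nil
  have "mat_adjoint (1\<^sub>m n :: complex mat) = 1\<^sub>m n"
  proof (rule eq_matI)
    fix i j assume "i < dim_row (1\<^sub>m n :: complex mat)" "j < dim_col (1\<^sub>m n :: complex mat)"
    then show "mat_adjoint (1\<^sub>m n :: complex mat) $$ (i, j) = 1\<^sub>m n $$ (i, j)"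
      by (simp add: mat_adjoint_index[of _ n])
  qed (use carrier_matD[OF mat_adjoint_carrier[OF one_carrier_mat]] in auto)
  then show ?case by simp
next
  case (Cons A As)
  then have A: "A \<in> carrier_mat n n" "mat_adjoint A \<in> carrier_mat n n"
    and As: "set As \<subseteq> carrier_mat n n" "set (rev (map mat_adjoint As)) \<subseteq> carrier_mat n n"
    by auto
  have "mat_prod n (rev (map mat_adjoint As) @ [mat_adjoint A]) =
      mat_prod n (rev (map mat_adjoint As)) * mat_adjoint A"
    using A by (subst mat_prod_append[OF As(2)]) (auto simp: right_mult_one_mat[of _ n n])
  then show ?case
    using Cons.IH[OF As(1)] mat_adjoint_mult[OF A(1) mat_prod_carrier[OF As(1)]] by simp
qed

lemma diag_proj_carrier [simp]: "diag_proj n ns j \<in> carrier_mat n n"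
  by (simp add: diag_proj_def)

lemma mat_adjoint_diag_proj: "mat_adjoint (diag_proj n ns j) = diag_proj n ns j"
proof (rule eq_matI)
  fix a b assume "a < dim_row (diag_proj n ns j)" "b < dim_col (diag_proj n ns j)"
  then have "a < n" "b < n" by (auto simp: diag_proj_def)
  then show "mat_adjoint (diag_proj n ns j) $$ (a, b) = diag_proj n ns j $$ (a, b)"
    by (simp add: mat_adjoint_index[of _ n]) (auto simp: diag_proj_def)
qed (use carrier_matD[OF mat_adjoint_carrier[OF diag_proj_carrier[of n ns j]]]
    carrier_matD[OF diag_proj_carrier[of n ns j]] in auto)

lemma mat_prod_diag_proj:
  "mat_prod n (map (diag_proj n ns) js) = mat n n (\<lambda>(a, b).
     if a = b \<and> (\<forall>j\<in>set js. sum ns {1..<j} \<le> a \<and> a < sum ns {1..j}) then 1 else 0)"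
proof (induction js)
  case Nil
  show ?case by (rule eq_matI) auto
next
  case (Cons j js)
  show ?case
  proof (rule eq_matI)
    fix a b
    assume "a < dim_row (mat n n (\<lambda>(a, b). if a = b \<and>
        (\<forall>j\<in>set (j # js). sum ns {1..<j} \<le> a \<and> a < sum ns {1..j}) then 1 else (0::complex)))"
      "b < dim_col (mat n n (\<lambda>(a, b). if a = b \<and>
        (\<forall>j\<in>set (j # js). sum ns {1..<j} \<le> a \<and> a < sum ns {1..j}) then 1 else (0::complex)))"
    then have ab: "a < n" "b < n" by auto
    define Q where "Q i a \<longleftrightarrow> sum ns {1..<i} \<le> a \<and> a < sum ns {1..i}" for i a
    have "mat_prod n (map (diag_proj n ns) (j # js)) $$ (a, b) =
        (\<Sum>i\<in>{0..<n}. (if a = i \<and> Q j a then 1 else 0) * (if i = b \<and> (\<forall>j\<in>set js. Q j i) then 1 else 0))"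
      using ab by (simp add: Cons diag_proj_def scalar_prod_def Q_def)
    also have "\<dots> = (\<Sum>i\<in>{0..<n}. if a = i then (if a = b \<and> Q j a \<and> (\<forall>j\<in>set js. Q j a) then 1 else 0) else 0)"
      by (intro sum.cong) auto
    also have "\<dots> = (if a = b \<and> Q j a \<and> (\<forall>j\<in>set js. Q j a) then 1 else 0)"
      using ab by (simp add: sum.delta)
    finally show "mat_prod n (map (diag_proj n ns) (j # js)) $$ (a, b) =
        mat n n (\<lambda>(a, b). if a = b \<and>
        (\<forall>j\<in>set (j # js). sum ns {1..<j} \<le> a \<and> a < sum ns {1..j}) then 1 else 0) $$ (a, b)"
      using ab by (simp add: Q_def)
  next
    have "set (map (diag_proj n ns) (j # js)) \<subseteq> carrier_mat n n" by auto
    note dims = carrier_matD[OF mat_prod_carrier[OF this]]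
    show "dim_row (mat_prod n (map (diag_proj n ns) (j # js))) = dim_row (mat n n (\<lambda>(a, b).
      if a = b \<and> (\<forall>j\<in>set (j # js). sum ns {1..<j} \<le> a \<and> a < sum ns {1..j}) then 1 else (0::complex)))"
      by (simp only: dims dim_row_mat)
    show "dim_col (mat_prod n (map (diag_proj n ns) (j # js))) = dim_col (mat n n (\<lambda>(a, b).
      if a = b \<and> (\<forall>j\<in>set (j # js). sum ns {1..<j} \<le> a \<and> a < sum ns {1..j}) then 1 else (0::complex)))"
      by (simp only: dims dim_col_mat)
  qed
qed

text \<open>
  The projections are orthogonal with sum one.  Hence a product of projections has the trace of
  \<open>D\<^sub>c\<close> if all its factors equal \<open>D\<^sub>c\<close>, it has trace \<open>0\<close> if two factors differ, and the empty product has
  the sum of all traces; the sum over \<open>c\<close> covers the three cases.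
\<close>

lemma trace_mat_prod_diag_proj:
  assumes "sum ns {1..q} = n" "set js \<subseteq> {1..q}"
  shows "mat_trace (mat_prod n (map (diag_proj n ns) js)) =
    (\<Sum>c | c \<in> {1..q} \<and> set js \<subseteq> {c}. of_nat (ns c))"
proof -
  define Q where "Q i a \<longleftrightarrow> sum ns {1..<i} \<le> a \<and> a < sum ns {1..i}" for i a
  have "mat_trace (mat_prod n (map (diag_proj n ns) js)) =
      (\<Sum>a<n. if \<forall>j\<in>set js. Q j a then 1 else 0)"
    by (simp add: mat_prod_diag_proj mat_trace_def Q_def)
  also have "\<dots> = of_nat (card {a. a < n \<and> (\<forall>j\<in>set js. Q j a)})"
    by (simp add: sum.If_cases Int_def)
  also have "\<dots> = (\<Sum>c | c \<in> {1..q} \<and> set js \<subseteq> {c}. of_nat (ns c))"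
  proof -
    consider "set js = {}" | c where "set js = {c}" | i j where "i \<in> set js" "j \<in> set js" "i < j"
      by (metis insertI1 is_singletonI' is_singleton_def linorder_neqE_nat insert_absorb all_not_in_conv)
    then show ?thesis
    proof cases
      case 1
      have "{c. c \<in> {1..q}} = {1..q}" by auto
      then show ?thesis using 1 assms(1) by (simp flip: of_nat_sum)
    next
      case 2
      then have c: "c \<in> {1..q}" using assms(2) by auto
      have "sum ns {1..c} \<le> n" unfolding assms(1)[symmetric] using c by (intro sum_mono2) auto
      then have "{a. a < n \<and> (\<forall>j\<in>set js. Q j a)} = {sum ns {1..<c}..<sum ns {1..c}}"
        using 2 by (auto simp: Q_def)
      moreover have "sum ns {1..c} = sum ns {1..<c} + ns c"
      proof -
        have "{1..c} = insert c {1..<c}" using c by auto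
        then show ?thesis by simp
      qed
      moreover have "{c'. c' \<in> {1..q} \<and> set js \<subseteq> {c'}} = {c}" using 2 c by auto
      ultimately show ?thesis by simp
    next
      case 3
      have "sum ns {1..i} \<le> sum ns {1..<j}" using 3 by (intro sum_mono2) auto
      then have "\<not> (Q i a \<and> Q j a)" for a unfolding Q_def by linarith
      then have "{a. a < n \<and> (\<forall>j\<in>set js. Q j a)} = {}" using 3 by blast
      moreover have "{c'. c' \<in> {1..q} \<and> set js \<subseteq> {c'}} = {}" using 3 by auto
      ultimately show ?thesis by (simp only: card.empty sum.empty of_nat_0)
    qed
  qed
  finally show ?thesis .
qed

text \<open>
  The adjoint of \<open>D\<^sub>l Y D\<^sub>l\<^sub>+\<^sub>1\<close> is \<open>D\<^sub>l\<^sub>+\<^sub>1 Y D\<^sub>l\<close>, so the factors of \<open>(B B\<^sup>*)\<^sup>k\<close> are indexed by the letters of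
  \<open>W\<^sup>k\<close> and each of them is a product of three letters of the joint family.
\<close>

lemma block_product_word:
  assumes Y: "\<And>l. l \<in> {1..p} \<Longrightarrow> Y (u l) \<in> carrier_mat n n"
    and herm: "\<And>l. l \<in> {1..p} \<Longrightarrow> hermitian_mat (Y (u l))"
  shows "diag_proj n ns 1 * (block_product n p ns Y u * mat_adjoint (block_product n p ns Y u)) ^\<^sub>m k =
    mat_prod n (map (case_sum Y (diag_proj n ns)) (Inr 1 # concat (map (letter_word u) (W_pow p k))))"
proof -
  define J where "J = case_sum Y (diag_proj n ns)"
  define lm where "lm x = diag_proj n ns (before_index x) * Y (u (letter_index x)) * diag_proj n ns (dim_index x)"
    for x
  define B where "B = block_product n p ns Y u"
  have lm_carrier: "lm x \<in> carrier_mat n n" if "letter_index x \<in> {1..p}" for x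
    unfolding lm_def using Y[OF that] by (metis diag_proj_carrier mult_carrier_mat)
  have W: "letter_index x \<in> {1..p}" if "x \<in> set (W p)" for x
    using that by (auto simp: W_def)
  have adj: "mat_adjoint (lm (Plain j)) = lm (Starred j)" if "j \<in> {1..p}" for j
    using Y[OF that] herm[OF that]
    by (simp add: lm_def mat_adjoint_mult[of _ n] mat_adjoint_diag_proj hermitian_mat_def
        assoc_mult_mat[of _ n n _ n _ n])
  have B: "B = mat_prod n (map lm (map Plain [1..<p+1]))"
    by (simp add: B_def block_product_def lm_def comp_def del: upt_Suc)
  moreover have "mat_adjoint B = mat_prod n (map lm (map Starred (rev [1..<p+1])))"
  proof -
    have "map mat_adjoint (map lm (map Plain [1..<p+1])) = map lm (map Starred [1..<p+1])"
      by (simp add: adj del: upt_Suc)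
    moreover have "mat_adjoint B = mat_prod n (rev (map mat_adjoint (map lm (map Plain [1..<p+1]))))"
      unfolding B by (rule mat_adjoint_mat_prod) (auto simp: lm_carrier)
    ultimately show ?thesis by (simp only: rev_map)
  qed
  ultimately have BB: "B * mat_adjoint B = mat_prod n (map lm (W p))"
    unfolding W_def map_append by (subst mat_prod_append) (auto simp: lm_carrier simp del: upt_Suc)
  have W_carrier: "set (map lm (W p)) \<subseteq> carrier_mat n n" using W lm_carrier by auto
  have "(B * mat_adjoint B) ^\<^sub>m k = mat_prod n (map lm (W_pow p k))"
  proof -
    have "mat_prod n (map lm (W_pow p k)) = mat_prod n (concat (replicate k (map lm (W p))))"
      by (simp add: W_pow_def map_concat)
    also have "\<dots> = mat_prod n (replicate k (mat_prod n (map lm (W p))))"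
      using W_carrier by (subst mat_prod_concat) auto
    also have "\<dots> = (B * mat_adjoint B) ^\<^sub>m k"
      unfolding BB by (rule mat_prod_replicate[OF mat_prod_carrier[OF W_carrier]])
    finally show ?thesis ..
  qed
  also have "\<dots> = mat_prod n (map J (concat (map (letter_word u) (W_pow p k))))"
  proof -
    have WW: "letter_index x \<in> {1..p}" if "x \<in> set (W_pow p k)" for x
      using that W by (auto simp: W_pow_def)
    have "mat_prod n (map J (letter_word u x)) = lm x" if "x \<in> set (W_pow p k)" for x
      using Y[OF WW[OF that]] by (simp add: letter_word_def J_def lm_def assoc_mult_mat[of _ n n _ n _ n]
          right_mult_one_mat[of _ n n])
    then have "map lm (W_pow p k) = map (mat_prod n) (map (map J) (map (letter_word u) (W_pow p k)))"
      by simp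
    moreover have "set As \<subseteq> carrier_mat n n" if "As \<in> set (map (map J) (map (letter_word u) (W_pow p k)))" for As
      using that Y WW by (auto simp: letter_word_def J_def)
    ultimately show ?thesis unfolding map_concat by (simp only: mat_prod_concat)
  qed
  finally show ?thesis by (simp add: B_def J_def)
qed

lemma joint_family_eq: "joint_family n ns Y i \<omega> = case_sum (\<lambda>v. Y v \<omega>) (diag_proj n ns) i"
  by (simp add: joint_family_def split: sum.split)

lemma tau_const:
  assumes "prob_space P"
  shows "tau P n (\<lambda>_. A) = mat_trace A / of_nat n"
proof -
  interpret prob_space P by fact
  show ?thesis by (simp add: tau_def prob_space)
qed

section \<open>The limit of the partial trace\<close>

theorem theorem3p1:
  fixes p k :: nat
    and dims :: "nat \<Rightarrow> nat \<Rightarrow> nat"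
    and d :: "nat \<Rightarrow> real"
    and M :: "nat \<Rightarrow> 'w measure"
    and U :: "'u set"
    and Y :: "nat \<Rightarrow> 'u \<Rightarrow> 'w \<Rightarrow> complex mat"
    and r :: "'u \<Rightarrow> nat \<Rightarrow> complex"
    and u :: "nat \<Rightarrow> 'u"
  assumes p: "1 \<le> p"
    and dims_sum: "\<And>n. (\<Sum>j=1..p+1. dims n j) = n"
    and dims_lim: "\<And>j. j \<in> {1..p+1} \<Longrightarrow> (\<lambda>n. real (dims n j) / real n) \<longlonglongrightarrow> d j"
    and dims_pos: "\<And>j. j \<in> {1..p+1} \<Longrightarrow> d j > 0"
    and prob: "\<And>n. prob_space (M n)"
    and U: "finite U"
    and size: "\<And>n v \<omega>. v \<in> U \<Longrightarrow> \<omega> \<in> space (M n) \<Longrightarrow> Y n v \<omega> \<in> carrier_mat n n"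
    and herm: "\<And>n v \<omega>. v \<in> U \<Longrightarrow> \<omega> \<in> space (M n) \<Longrightarrow> hermitian_mat (Y n v \<omega>)"
    and indep: "\<And>n. indep_random_matrices (M n) n (Y n) U"
    and A1: "asymptotically_free M Y ((\<lambda>v. {v}) ` U)"
    and A2: "asymptotically_free M (\<lambda>n. joint_family n (dims n) (Y n))
               {Inl ` U, Inr ` {1..p+1}}"
    and A3: "\<exists>C. \<forall>n. \<forall>v\<in>U. AE \<omega> in M n. mat_op_norm (Y n v \<omega>) \<le> C"
    and cumulants: "\<And>v. v \<in> U \<Longrightarrow> free_cumulants (limit_moment M (\<lambda>n. Y n v)) (r v)"
    and labels: "\<And>l. l \<in> {1..p} \<Longrightarrow> u l \<in> U"
  shows "(\<lambda>n. tau_part (M n) n (dims n) 1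
            (\<lambda>\<omega>. let B = block_product n p (dims n) (\<lambda>v. Y n v \<omega>) u
                 in (B * mat_adjoint B) ^\<^sub>m k))
         \<longlonglongrightarrow> (\<Sum>\<pi>\<in>NC_W p k u. \<Prod>V\<in>\<pi>. block_weight p k d r u V)"
proof -
  define C where "C = {1..p+1}"
  have l1: "1 \<in> {1..p}" and C1: "1 \<in> C" using p by (auto simp: C_def)
  have U_ne: "U \<noteq> {}" using labels[OF l1] by auto
  obtain \<mu> where \<mu>: "\<And>w. set w \<subseteq> U \<Longrightarrow> (\<lambda>n. mixed_moment (M n) n (Y n) w) \<longlonglongrightarrow> \<mu> w"
    and \<mu>_free: "free_wrt (nc_functional \<mu>) ((\<lambda>v. {v}) ` U)"
    using A1 unfolding asymptotically_free_def by auto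
  obtain \<kappa> where \<kappa>: "\<And>w. set w \<subseteq> Inl ` U \<union> Inr ` C \<Longrightarrow>
      (\<lambda>n. mixed_moment (M n) n (joint_family n (dims n) (Y n)) w) \<longlonglongrightarrow> \<kappa> w"
    and \<kappa>_free: "free_wrt (nc_functional \<kappa>) {Inl ` U, Inr ` C}"
    using A2 unfolding asymptotically_free_def C_def by auto
  have ev: "eventually (\<lambda>n::nat. n > 0) sequentially" by (rule eventually_gt_at_top)
  have sum_d: "(\<Sum>c\<in>C. d c) = 1"
  proof (rule LIMSEQ_unique)
    show "(\<lambda>n. \<Sum>c\<in>C. real (dims n c) / real n) \<longlonglongrightarrow> (\<Sum>c\<in>C. d c)"
      unfolding C_def by (intro tendsto_sum dims_lim)
    have "eventually (\<lambda>n. (\<Sum>c\<in>C. real (dims n c) / real n) = 1) sequentially"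
      using ev
    proof eventually_elim
      case (elim n)
      then show ?case
        unfolding sum_divide_distrib[symmetric] of_nat_sum[symmetric] C_def dims_sum by simp
    qed
    then show "(\<lambda>n. \<Sum>c\<in>C. real (dims n c) / real n) \<longlonglongrightarrow> 1" by (rule tendsto_eventually)
  qed
  have fock: "fock_model C (\<lambda>j. of_real (d j) :: complex)"
  proof
    show "finite C" by (simp add: C_def)
    show "(\<Sum>c\<in>C. of_real (d c) :: complex) = 1" by (simp only: of_real_sum[symmetric] sum_d of_real_1)
  qed
  interpret fock_model C "\<lambda>j. of_real (d j) :: complex" r by (rule fock)
  define \<psi> where "\<psi> w = vac_state (foldr op_letter w vac)" for w
  \<comment> \<open>The limit distribution of the \<open>Y(v)\<close> is that of the model: first for powers of one matrix by
    the moment-cumulant formula, then for all words by freeness.\<close>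
  have \<mu>_Nil: "\<mu> [] = 1"
  proof (rule LIMSEQ_unique)
    show "(\<lambda>n. mixed_moment (M n) n (Y n) []) \<longlonglongrightarrow> \<mu> []" by (rule \<mu>) simp
    have "eventually (\<lambda>n. mixed_moment (M n) n (Y n) [] = 1) sequentially"
      using ev by eventually_elim (simp add: mixed_moment_def tau_const[OF prob] mat_trace_def)
    then show "(\<lambda>n. mixed_moment (M n) n (Y n) []) \<longlonglongrightarrow> 1" by (rule tendsto_eventually)
  qed
  have \<mu>_single: "\<mu> (replicate m v) = coef (replicate m v) []" if v: "v \<in> U" for m v
  proof (cases "m = 0")
    case True
    then show ?thesis by (simp add: \<mu>_Nil coef_def)
  next
    case False
    have "tau (M n) n (\<lambda>\<omega>. Y n v \<omega> ^\<^sub>m m) = mixed_moment (M n) n (Y n) (replicate m v)" for n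
      unfolding mixed_moment_def tau_def
      by (intro arg_cong2[of _ _ _ _ "(*)"] refl Bochner_Integration.integral_cong)
        (simp_all add: mat_prod_replicate size[OF v])
    then have "(\<lambda>n. tau (M n) n (\<lambda>\<omega>. Y n v \<omega> ^\<^sub>m m)) \<longlonglongrightarrow> \<mu> (replicate m v)"
      using \<mu>[of "replicate m v"] v False by simp
    then have "\<mu> (replicate m v) = limit_moment M (\<lambda>n. Y n v) m"
      unfolding limit_moment_def by (rule limI[symmetric])
    also have "\<dots> = (\<Sum>\<pi>\<in>NC m. \<Prod>V\<in>\<pi>. r v (card V))"
      using cumulants[OF v] False by (simp add: free_cumulants_def)
    also have "\<dots> = coef (replicate m v) []"
      using nc_sum_eq_coef[of "[]" "[1..<Suc m]" v] by (simp add: nc_sum_NC[symmetric] del: upt_Suc One_nat_def)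
    finally show ?thesis .
  qed
  have \<mu>_eq: "\<mu> w = coef w []" if "set w \<subseteq> U" for w
    unfolding vac_state_foldr_op_Y[symmetric]
  proof (rule free_wrt_unique[OF \<mu>_free free_wrt_op_Y])
    fix G w assume "G \<in> (\<lambda>v. {v}) ` U" "set w \<subseteq> G"
    then obtain v where v: "v \<in> U" "set w \<subseteq> {v}" by auto
    then have "replicate (length w) v = w" by (intro replicate_eqI[symmetric]) auto
    then show "\<mu> w = vac_state (foldr op_Y w vac)"
      using \<mu>_single[OF v(1), of "length w"] by (simp add: vac_state_foldr_op_Y)
  qed (use U_ne \<mu>_Nil that in auto)
  \<comment> \<open>The joint limit distribution is that of the model on words in the \<open>Y(v)\<close> and on words in
    the projections, hence on all words by freeness of the two classes.\<close>
  have \<kappa>_Inl: "\<kappa> w = \<psi> w" if w: "set w \<subseteq> Inl ` U" for w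
  proof -
    define x where "x = map projl w"
    have wx: "w = map Inl x" unfolding x_def map_map by (rule map_idI[symmetric]) (use w in auto)
    have x: "set x \<subseteq> U" using w by (auto simp: x_def)
    have "mixed_moment (M n) n (joint_family n (dims n) (Y n)) w = mixed_moment (M n) n (Y n) x" for n
      by (simp add: mixed_moment_def wx joint_family_def comp_def)
    moreover have "(\<lambda>n. mixed_moment (M n) n (joint_family n (dims n) (Y n)) w) \<longlonglongrightarrow> \<kappa> w"
      by (rule \<kappa>) (use w in auto)
    ultimately have "\<kappa> w = \<mu> x" using \<mu>[OF x] by (simp add: LIMSEQ_unique)
    then show ?thesis
      by (simp add: \<mu>_eq[OF x] \<psi>_def wx foldr_op_letter_Inl vac_state_foldr_op_Y)
  qed
  have \<kappa>_Inr: "\<kappa> w = \<psi> w" if w: "set w \<subseteq> Inr ` C" for w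
  proof -
    define js where "js = map projr w"
    have wj: "w = map Inr js" unfolding js_def map_map by (rule map_idI[symmetric]) (use w in auto)
    have js: "set js \<subseteq> C" using w by (auto simp: js_def)
    have "mixed_moment (M n) n (joint_family n (dims n) (Y n)) w =
        (\<Sum>c | c \<in> C \<and> set js \<subseteq> {c}. of_real (real (dims n c) / real n))" for n
    proof -
      have "mixed_moment (M n) n (joint_family n (dims n) (Y n)) w =
          mat_trace (mat_prod n (map (diag_proj n (dims n)) js)) / of_nat n"
        by (simp add: mixed_moment_def wj joint_family_def comp_def tau_const[OF prob])
      also have "\<dots> = (\<Sum>c | c \<in> C \<and> set js \<subseteq> {c}. of_nat (dims n c)) / of_nat n"
        using trace_mat_prod_diag_proj[OF dims_sum] js unfolding C_def by simp
      finally show ?thesis by (simp add: sum_divide_distrib)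
    qed
    moreover have "(\<lambda>n. \<Sum>c | c \<in> C \<and> set js \<subseteq> {c}. of_real (real (dims n c) / real n) :: complex)
        \<longlonglongrightarrow> (\<Sum>c | c \<in> C \<and> set js \<subseteq> {c}. of_real (d c))"
      by (intro tendsto_sum tendsto_of_real dims_lim) (auto simp: C_def)
    moreover have "(\<lambda>n. mixed_moment (M n) n (joint_family n (dims n) (Y n)) w) \<longlonglongrightarrow> \<kappa> w"
      by (rule \<kappa>) (use w in auto)
    ultimately have "\<kappa> w = (\<Sum>c | c \<in> C \<and> set js \<subseteq> {c}. of_real (d c))"
      by (simp only: LIMSEQ_unique)
    also have "\<dots> = \<psi> w"
    proof -
      have "{c. c \<in> C \<and> set js \<subseteq> {c}} = {c \<in> C. set w \<subseteq> {Inr c}}" by (auto simp: wj)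
      then show ?thesis using w by (subst \<psi>_def, subst vac_state_foldr_Inr) auto
    qed
    finally show ?thesis .
  qed
  have \<kappa>_eq: "\<kappa> w = \<psi> w" if "set w \<subseteq> Inl ` U \<union> Inr ` C" for w
  proof (rule free_wrt_unique[OF \<kappa>_free])
    show "free_wrt (nc_functional \<psi>) {Inl ` U, Inr ` C}"
      using free_wrt_op_letter by (simp add: \<psi>_def[abs_def])
    show "\<kappa> [] = 1"
      using \<kappa>_Inl[of "[]"] sum_d by (simp add: \<psi>_def vac_state_def vac_def flip: of_real_sum)
  qed (use \<kappa>_Inl \<kappa>_Inr that in auto)
  define w where "w = Inr 1 # concat (map (letter_word u) (W_pow p k))"
  have w: "set w \<subseteq> Inl ` U \<union> Inr ` C"
  proof -
    have "letter_index x \<in> {1..p} \<and> before_index x \<in> C \<and> dim_index x \<in> C" if "x \<in> set (W_pow p k)" for x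
    proof -
      have "x \<in> set (W p)" using that by (auto simp: W_pow_def)
      then show ?thesis using p by (auto simp: W_def C_def simp del: upt_Suc)
    qed
    then show ?thesis using labels C1 by (auto simp: w_def letter_word_def)
  qed
  let ?T = "\<lambda>n. tau_part (M n) n (dims n) 1
      (\<lambda>\<omega>. let B = block_product n p (dims n) (\<lambda>v. Y n v \<omega>) u in (B * mat_adjoint B) ^\<^sub>m k)"
  let ?S = "\<Sum>\<pi>\<in>NC_W p k u. \<Prod>V\<in>\<pi>. block_weight p k d r u V"
  let ?m = "\<lambda>n. mixed_moment (M n) n (joint_family n (dims n) (Y n)) w"
  have T: "?T n = ?m n / of_real (real (dims n 1) / real n)" if "n > 0" for n
  proof -
    have "(\<integral>\<omega>. mat_trace (diag_proj n (dims n) 1 *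
        (let B = block_product n p (dims n) (\<lambda>v. Y n v \<omega>) u in (B * mat_adjoint B) ^\<^sub>m k)) \<partial>M n) =
      (\<integral>\<omega>. mat_trace (mat_prod n (map (\<lambda>i. joint_family n (dims n) (Y n) i \<omega>) w)) \<partial>M n)"
    proof (rule Bochner_Integration.integral_cong[OF refl])
      fix \<omega> assume \<omega>: "\<omega> \<in> space (M n)"
      show "mat_trace (diag_proj n (dims n) 1 *
          (let B = block_product n p (dims n) (\<lambda>v. Y n v \<omega>) u in (B * mat_adjoint B) ^\<^sub>m k)) =
        mat_trace (mat_prod n (map (\<lambda>i. joint_family n (dims n) (Y n) i \<omega>) w))"
        using block_product_word[of p "\<lambda>v. Y n v \<omega>" u n "dims n" k] size[OF labels \<omega>] herm[OF labels \<omega>]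
        by (simp add: Let_def joint_family_eq w_def)
    qed
    then show ?thesis using that by (simp add: tau_part_def mixed_moment_def tau_def)
  qed
  have "\<psi> w = of_real (d 1) * ?S"
    unfolding \<psi>_def w_def using vac_state_W_pow[OF p, of d r u k] fock unfolding C_def by simp
  then have "?m \<longlonglongrightarrow> of_real (d 1) * ?S" using \<kappa>[OF w] \<kappa>_eq[OF w] by simp
  moreover have d1: "(\<lambda>n. of_real (real (dims n 1) / real n) :: complex) \<longlonglongrightarrow> of_real (d 1)"
    by (intro tendsto_of_real dims_lim) simp
  moreover have "of_real (d 1) \<noteq> (0 :: complex)" using dims_pos[of 1] by simp
  ultimately have "(\<lambda>n. ?m n / of_real (real (dims n 1) / real n)) \<longlonglongrightarrow> of_real (d 1) * ?S / of_real (d 1)"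
    by (intro tendsto_divide)
  then have "(\<lambda>n. ?m n / of_real (real (dims n 1) / real n)) \<longlonglongrightarrow> ?S"
    using dims_pos[of 1] by simp
  moreover have "eventually (\<lambda>n. ?m n / of_real (real (dims n 1) / real n) = ?T n) sequentially"
    using ev by eventually_elim (simp only: T)
  ultimately show ?thesis by (rule Lim_transform_eventually)
qed

end
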